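(* Let $A$, $B$, $R$ be bialgebras in a braided monoidal category $(\mathfrak{M},\otimes,\mathbf{1},c)$, and let $\sigma:B\to A$ and $i:R\to A$ be bialgebra morphisms such that $\Phi:=m_A(i\otimes\sigma):R\otimes B\to A$ is an isomorphism in $\mathfrak{M}$. Let $\Theta:=m_A(\sigma\otimes i):B\otimes R\to A$ and $\Psi:=\Phi^{-1}\Theta:B\otimes R\to R\otimes B$. Define $\vartriangleright:B\otimes R\to R$ and $\vartriangleleft:B\otimes R\to B$ by $$\vartriangleright:=r_R(R\otimes\varepsilon_B)\Psi,\qquad \vartriangleleft:=l_B(\varepsilon_R\otimes B)\Psi .$$ Then $(R,B,\vartriangleright,\vartriangleleft)$ is a matched pair of bialgebras in $\mathfrak{M}$ and $A\simeq R\Join B$ as bialgebras, where $R\Join B$ is the double cross product bialgebra of this matched pair.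
   Context: Conventions: associativity constraints are suppressed; an object used as a morphism denotes its identity; $l_X:\mathbf{1}\otimes X\to X$ and $r_X:X\otimes\mathbf{1}\to X$ are the unit constraints; $m_{\mathbf 1}:\mathbf 1\otimes\mathbf 1\to\mathbf 1$ is the canonical isomorphism and $\Delta_{\mathbf 1}$ its inverse. The braiding is a natural isomorphism $c_{X,Y}:X\otimes Y\to Y\otimes X$ with $c_{X\otimes Y,Z}=(c_{X,Z}\otimes Y)(X\otimes c_{Y,Z})$ and $c_{X,Y\otimes Z}=(Y\otimes c_{X,Z})(c_{X,Y}\otimes Z)$. A bialgebra $(B,m_B,u_B,\Delta_B,\varepsilon_B)$ in $\mathfrak{M}$ is an algebra and a coalgebra with $\Delta_B m_B=(m_B\otimes m_B)(B\otimes c_{B,B}\otimes B)(\Delta_B\otimes\Delta_B)$, $\varepsilon_B m_B=m_{\mathbf 1}(\varepsilon_B\otimes\varepsilon_B)$, $\Delta_B u_B=(u_B\otimes u_B)\Delta_{\mathbf 1}$, $\varepsilon_B u_B=\mathrm{Id}_{\mathbf 1}$. For bialgebras $R,B$, the tensor product coalgebra $B\otimes R$ has $\Delta_{B\otimes R}=(B\otimes c_{B,R}\otimes R)(\Delta_B\otimes\Delta_R)$ and $\varepsilon_{B\otimes R}=m_{\mathbf 1}(\varepsilon_B\otimes\varepsilon_R)$. Matched pair: $(R,B,\vartriangleright,\vartriangleleft)$, with morphisms $\vartriangleright:B\otimes R\to R$ and $\vartriangleleft:B\otimes R\to B$, is a matched pair of bialgebras if (1) $(R,\Delta_R,\varepsilon_R,\vartriangleright)$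 is a left $B$-module coalgebra (i.e. $\vartriangleright$ is a left action of the algebra $B$ and a coalgebra morphism $B\otimes R\to R$); (2) $(B,\Delta_B,\varepsilon_B,\vartriangleleft)$ is a right $R$-module coalgebra (i.e. $\vartriangleleft$ is a right action of the algebra $R$ and a coalgebra morphism $B\otimes R\to B$); (3) $\vartriangleleft(u_B\otimes R)=u_B\varepsilon_R l_R$; (4) $\vartriangleright(B\otimes u_R)=u_R\varepsilon_B r_B$; (5) $m_B(\vartriangleleft\otimes B)(B\otimes\vartriangleright\otimes\vartriangleleft)(B\otimes\Delta_{B\otimes R})=\vartriangleleft(m_B\otimes R)$; (6) $m_R(R\otimes\vartriangleright)(\vartriangleright\otimes\vartriangleleft\otimes R)(\Delta_{B\otimes R}\otimes R)=\vartriangleright(B\otimes m_R)$; (7) $(\vartriangleleft\otimes\vartriangleright)\Delta_{B\otimes R}=c_{R,B}(\vartriangleright\otimes\vartriangleleft)\Delta_{B\otimes R}$. Double cross product: for a matched pair, $R\Join B$ is the bialgebra on $R\otimes B$ with $m_{R\Join B}=(m_R\otimes m_B)(R\otimes\vartriangleright\otimes\vartriangleleft\otimes B)(R\otimes B\otimes c_{B,R}\otimes R\otimes B)(R\otimes\Delta_B\otimes\Delta_R\otimes B)$, $u_{R\Join B}=(u_R\otimes u_B)\Delta_{\mathbf 1}$, $\Delta_{R\Join B}=(R\otimes c_{R,B}\otimes B)(\Delta_R\otimes\Delta_B)$, $\varepsilon_{R\Join B}=m_{\mathbf 1}(\varepsilon_R\otimes\varepsilon_B)$. *)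

theory Defs
  imports Main
begin

section \<open>Braided monoidal categories\<close>

text \<open>
  A category has a set of objects and a set of arrows, each arrow carrying its domain and
  codomain. Operations are total on the underlying types and only constrained on these sets.
  Composition is written in applicative order.
\<close>

record ('o, 'm) category =
  Obj :: "'o set"
  Arr :: "'m set"
  Dom :: "'m \<Rightarrow> 'o"
  Cod :: "'m \<Rightarrow> 'o"
  Idn :: "'o \<Rightarrow> 'm"  ("id\<index>")
  Comp :: "'m \<Rightarrow> 'm \<Rightarrow> 'm"  (infixr "\<cdot>\<index>" 55)

definition Hom :: "('o, 'm, 'x) category_scheme \<Rightarrow> 'o \<Rightarrow> 'o \<Rightarrow> 'm set" where
  "Hom C X Y = {f \<in> Arr C. Dom C f = X \<and> Cod C f = Y}"

definition inverse_arrows :: "('o, 'm, 'x) category_scheme \<Rightarrow> 'm \<Rightarrow> 'm \<Rightarrow> bool" where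
  "inverse_arrows C f g \<longleftrightarrow>
     f \<in> Arr C \<and> g \<in> Hom C (Cod C f) (Dom C f) \<and>
     g \<cdot>\<^bsub>C\<^esub> f = Idn C (Dom C f) \<and> f \<cdot>\<^bsub>C\<^esub> g = Idn C (Cod C f)"

definition is_iso :: "('o, 'm, 'x) category_scheme \<Rightarrow> 'm \<Rightarrow> bool" where
  "is_iso C f \<longleftrightarrow> (\<exists>g. inverse_arrows C f g)"

definition inv_arr :: "('o, 'm, 'x) category_scheme \<Rightarrow> 'm \<Rightarrow> 'm"  ("inv\<index>") where
  "inv_arr C f = (THE g. inverse_arrows C f g)"

locale category =
  fixes C :: "('o, 'm, 'x) category_scheme" (structure)
  assumes Dom_in_Obj: "f \<in> Arr C \<Longrightarrow> Dom C f \<in> Obj C"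
    and Cod_in_Obj: "f \<in> Arr C \<Longrightarrow> Cod C f \<in> Obj C"
    and id_in_hom: "X \<in> Obj C \<Longrightarrow> id X \<in> Hom C X X"
    and comp_in_hom: "f \<in> Hom C X Y \<Longrightarrow> g \<in> Hom C Y Z \<Longrightarrow> g \<cdot> f \<in> Hom C X Z"
    and id_comp: "f \<in> Hom C X Y \<Longrightarrow> id Y \<cdot> f = f"
    and comp_id: "f \<in> Hom C X Y \<Longrightarrow> f \<cdot> id X = f"
    and comp_assoc: "f \<in> Hom C W X \<Longrightarrow> g \<in> Hom C X Y \<Longrightarrow> h \<in> Hom C Y Z
                       \<Longrightarrow> (h \<cdot> g) \<cdot> f = h \<cdot> (g \<cdot> f)"

text \<open>
  The tensor product is \<open>X \<otimes> Y\<close> on objects and \<open>f \<boxtimes> g\<close> on arrows. The constraints are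
  \<open>\<a> X Y Z : (X \<otimes> Y) \<otimes> Z \<rightarrow> X \<otimes> (Y \<otimes> Z)\<close>, \<open>\<l> X : \<one> \<otimes> X \<rightarrow> X\<close> and \<open>\<r> X : X \<otimes> \<one> \<rightarrow> X\<close>.
\<close>

record ('o, 'm) monoidal_category = "('o, 'm) category" +
  TensorObj :: "'o \<Rightarrow> 'o \<Rightarrow> 'o"  (infix "\<otimes>\<index>" 70)
  TensorArr :: "'m \<Rightarrow> 'm \<Rightarrow> 'm"  (infix "\<boxtimes>\<index>" 70)
  UnitObj :: "'o"  ("\<one>\<index>")
  Assoc :: "'o \<Rightarrow> 'o \<Rightarrow> 'o \<Rightarrow> 'm"  ("\<a>\<index>")
  LUnit :: "'o \<Rightarrow> 'm"  ("\<l>\<index>")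
  RUnit :: "'o \<Rightarrow> 'm"  ("\<r>\<index>")

locale monoidal_category = category C
  for C :: "('o, 'm, 'x) monoidal_category_scheme" (structure) +
  assumes tensor_in_Obj: "X \<in> Obj C \<Longrightarrow> Y \<in> Obj C \<Longrightarrow> X \<otimes> Y \<in> Obj C"
    and unit_in_Obj: "\<one> \<in> Obj C"
    and tensor_in_hom: "f \<in> Hom C X X' \<Longrightarrow> g \<in> Hom C Y Y'
                          \<Longrightarrow> f \<boxtimes> g \<in> Hom C (X \<otimes> Y) (X' \<otimes> Y')"
    and tensor_id: "X \<in> Obj C \<Longrightarrow> Y \<in> Obj C \<Longrightarrow> id X \<boxtimes> id Y = id (X \<otimes> Y)"
    and tensor_comp: "f \<in> Hom C X X' \<Longrightarrow> f' \<in> Hom C X' X''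
                        \<Longrightarrow> g \<in> Hom C Y Y' \<Longrightarrow> g' \<in> Hom C Y' Y''
                        \<Longrightarrow> (f' \<cdot> f) \<boxtimes> (g' \<cdot> g) = (f' \<boxtimes> g') \<cdot> (f \<boxtimes> g)"
    and assoc_in_hom: "X \<in> Obj C \<Longrightarrow> Y \<in> Obj C \<Longrightarrow> Z \<in> Obj C
                         \<Longrightarrow> \<a> X Y Z \<in> Hom C ((X \<otimes> Y) \<otimes> Z) (X \<otimes> (Y \<otimes> Z))"
    and assoc_iso: "X \<in> Obj C \<Longrightarrow> Y \<in> Obj C \<Longrightarrow> Z \<in> Obj C \<Longrightarrow> is_iso C (\<a> X Y Z)"
    and assoc_natural: "f \<in> Hom C X X' \<Longrightarrow> g \<in> Hom C Y Y' \<Longrightarrow> h \<in> Hom C Z Z'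
                          \<Longrightarrow> \<a> X' Y' Z' \<cdot> ((f \<boxtimes> g) \<boxtimes> h) = (f \<boxtimes> (g \<boxtimes> h)) \<cdot> \<a> X Y Z"
    and lunit_in_hom: "X \<in> Obj C \<Longrightarrow> \<l> X \<in> Hom C (\<one> \<otimes> X) X"
    and lunit_iso: "X \<in> Obj C \<Longrightarrow> is_iso C (\<l> X)"
    and lunit_natural: "f \<in> Hom C X Y \<Longrightarrow> \<l> Y \<cdot> (id \<one> \<boxtimes> f) = f \<cdot> \<l> X"
    and runit_in_hom: "X \<in> Obj C \<Longrightarrow> \<r> X \<in> Hom C (X \<otimes> \<one>) X"
    and runit_iso: "X \<in> Obj C \<Longrightarrow> is_iso C (\<r> X)"
    and runit_natural: "f \<in> Hom C X Y \<Longrightarrow> \<r> Y \<cdot> (f \<boxtimes> id \<one>) = f \<cdot> \<r> X"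
    and pentagon: "W \<in> Obj C \<Longrightarrow> X \<in> Obj C \<Longrightarrow> Y \<in> Obj C \<Longrightarrow> Z \<in> Obj C
                     \<Longrightarrow> (id W \<boxtimes> \<a> X Y Z) \<cdot> \<a> W (X \<otimes> Y) Z \<cdot> (\<a> W X Y \<boxtimes> id Z)
                         = \<a> W X (Y \<otimes> Z) \<cdot> \<a> (W \<otimes> X) Y Z"
    and triangle: "X \<in> Obj C \<Longrightarrow> Y \<in> Obj C
                     \<Longrightarrow> (id X \<boxtimes> \<l> Y) \<cdot> \<a> X \<one> Y = \<r> X \<boxtimes> id Y"

record ('o, 'm) braided_monoidal_category = "('o, 'm) monoidal_category" +
  Braid :: "'o \<Rightarrow> 'o \<Rightarrow> 'm"  ("\<c>\<index>")

locale braided_monoidal_category = monoidal_category C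
  for C :: "('o, 'm, 'x) braided_monoidal_category_scheme" (structure) +
  assumes braid_in_hom: "X \<in> Obj C \<Longrightarrow> Y \<in> Obj C \<Longrightarrow> \<c> X Y \<in> Hom C (X \<otimes> Y) (Y \<otimes> X)"
    and braid_iso: "X \<in> Obj C \<Longrightarrow> Y \<in> Obj C \<Longrightarrow> is_iso C (\<c> X Y)"
    and braid_natural: "f \<in> Hom C X X' \<Longrightarrow> g \<in> Hom C Y Y'
                          \<Longrightarrow> \<c> X' Y' \<cdot> (f \<boxtimes> g) = (g \<boxtimes> f) \<cdot> \<c> X Y"
    and hexagon_left: "X \<in> Obj C \<Longrightarrow> Y \<in> Obj C \<Longrightarrow> Z \<in> Obj C
      \<Longrightarrow> \<c> (X \<otimes> Y) Z
          = \<a> Z X Y \<cdot> (\<c> X Z \<boxtimes> id Y) \<cdot> inv (\<a> X Z Y) \<cdot> (id X \<boxtimes> \<c> Y Z) \<cdot> \<a> X Y Z"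
    and hexagon_right: "X \<in> Obj C \<Longrightarrow> Y \<in> Obj C \<Longrightarrow> Z \<in> Obj C
      \<Longrightarrow> \<c> X (Y \<otimes> Z)
          = inv (\<a> Y Z X) \<cdot> (id Y \<boxtimes> \<c> X Z) \<cdot> \<a> Y X Z \<cdot> (\<c> X Y \<boxtimes> id Z) \<cdot> inv (\<a> X Y Z)"


section \<open>Bialgebras, matched pairs and double cross products\<close>

record ('o, 'm) bialgebra =
  Carrier :: 'o
  Mult :: 'm
  Unit :: 'm
  Comult :: 'm
  Counit :: 'm

context
  fixes C :: "('o, 'm, 'x) braided_monoidal_category_scheme" (structure)
begin

text \<open>
  Associativity constraints are written out. By coherence, which composite of them is used
  between two given bracketings is immaterial.
\<close>

definition mult_unit :: 'm where
  "mult_unit = \<l> \<one>"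

definition comult_unit :: 'm where
  "comult_unit = inv mult_unit"

text \<open>The canonical isomorphism \<open>(W \<otimes> X) \<otimes> (Y \<otimes> Z) \<rightarrow> W \<otimes> ((X \<otimes> Y) \<otimes> Z)\<close>.\<close>

definition rebracket :: "'o \<Rightarrow> 'o \<Rightarrow> 'o \<Rightarrow> 'o \<Rightarrow> 'm" where
  "rebracket W X Y Z = (id W \<boxtimes> inv (\<a> X Y Z)) \<cdot> \<a> W X (Y \<otimes> Z)"

text \<open>
  The arrow \<open>(W \<otimes> X) \<otimes> (Y \<otimes> Z) \<rightarrow> (W \<otimes> Y) \<otimes> (X \<otimes> Z)\<close> that is \<open>W \<otimes> c\<^sub>X\<^sub>,\<^sub>Y \<otimes> Z\<close> when
  associativity constraints are suppressed.
\<close>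

definition middle_braid :: "'o \<Rightarrow> 'o \<Rightarrow> 'o \<Rightarrow> 'o \<Rightarrow> 'm" where
  "middle_braid W X Y Z =
     inv (rebracket W Y X Z) \<cdot> (id W \<boxtimes> (\<c> X Y \<boxtimes> id Z)) \<cdot> rebracket W X Y Z"

definition is_algebra :: "'o \<Rightarrow> 'm \<Rightarrow> 'm \<Rightarrow> bool" where
  "is_algebra X m u \<longleftrightarrow>
     X \<in> Obj C \<and> m \<in> Hom C (X \<otimes> X) X \<and> u \<in> Hom C \<one> X \<and>
     m \<cdot> (m \<boxtimes> id X) = m \<cdot> (id X \<boxtimes> m) \<cdot> \<a> X X X \<and>
     m \<cdot> (u \<boxtimes> id X) = \<l> X \<and>
     m \<cdot> (id X \<boxtimes> u) = \<r> X"

definition is_coalgebra :: "'o \<Rightarrow> 'm \<Rightarrow> 'm \<Rightarrow> bool" where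
  "is_coalgebra X \<Delta> \<epsilon> \<longleftrightarrow>
     X \<in> Obj C \<and> \<Delta> \<in> Hom C X (X \<otimes> X) \<and> \<epsilon> \<in> Hom C X \<one> \<and>
     \<a> X X X \<cdot> (\<Delta> \<boxtimes> id X) \<cdot> \<Delta> = (id X \<boxtimes> \<Delta>) \<cdot> \<Delta> \<and>
     \<l> X \<cdot> (\<epsilon> \<boxtimes> id X) \<cdot> \<Delta> = id X \<and>
     \<r> X \<cdot> (id X \<boxtimes> \<epsilon>) \<cdot> \<Delta> = id X"

definition algebra_hom :: "'o \<Rightarrow> 'm \<Rightarrow> 'm \<Rightarrow> 'o \<Rightarrow> 'm \<Rightarrow> 'm \<Rightarrow> 'm \<Rightarrow> bool" where
  "algebra_hom X m u X' m' u' f \<longleftrightarrow>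
     f \<in> Hom C X X' \<and> f \<cdot> m = m' \<cdot> (f \<boxtimes> f) \<and> f \<cdot> u = u'"

definition coalgebra_hom :: "'o \<Rightarrow> 'm \<Rightarrow> 'm \<Rightarrow> 'o \<Rightarrow> 'm \<Rightarrow> 'm \<Rightarrow> 'm \<Rightarrow> bool" where
  "coalgebra_hom X \<Delta> \<epsilon> X' \<Delta>' \<epsilon>' f \<longleftrightarrow>
     f \<in> Hom C X X' \<and> \<Delta>' \<cdot> f = (f \<boxtimes> f) \<cdot> \<Delta> \<and> \<epsilon>' \<cdot> f = \<epsilon>"

definition is_bialgebra :: "('o, 'm) bialgebra \<Rightarrow> bool" where
  "is_bialgebra B \<longleftrightarrow>
     is_algebra (Carrier B) (Mult B) (Unit B) \<and>
     is_coalgebra (Carrier B) (Comult B) (Counit B) \<and>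
     Comult B \<cdot> Mult B =
       (Mult B \<boxtimes> Mult B) \<cdot> middle_braid (Carrier B) (Carrier B) (Carrier B) (Carrier B)
         \<cdot> (Comult B \<boxtimes> Comult B) \<and>
     Counit B \<cdot> Mult B = mult_unit \<cdot> (Counit B \<boxtimes> Counit B) \<and>
     Comult B \<cdot> Unit B = (Unit B \<boxtimes> Unit B) \<cdot> comult_unit \<and>
     Counit B \<cdot> Unit B = id \<one>"

definition bialgebra_hom :: "('o, 'm) bialgebra \<Rightarrow> ('o, 'm) bialgebra \<Rightarrow> 'm \<Rightarrow> bool" where
  "bialgebra_hom B B' f \<longleftrightarrow>
     algebra_hom (Carrier B) (Mult B) (Unit B) (Carrier B') (Mult B') (Unit B') f \<and>
     coalgebra_hom (Carrier B) (Comult B) (Counit B) (Carrier B') (Comult B') (Counit B') f"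

definition isomorphic_bialgebras :: "('o, 'm) bialgebra \<Rightarrow> ('o, 'm) bialgebra \<Rightarrow> bool" where
  "isomorphic_bialgebras B B' \<longleftrightarrow>
     is_bialgebra B \<and> is_bialgebra B' \<and> (\<exists>f. bialgebra_hom B B' f \<and> is_iso C f)"

definition tensor_comult :: "('o, 'm) bialgebra \<Rightarrow> ('o, 'm) bialgebra \<Rightarrow> 'm" where
  "tensor_comult B R =
     middle_braid (Carrier B) (Carrier B) (Carrier R) (Carrier R) \<cdot> (Comult B \<boxtimes> Comult R)"

definition tensor_counit :: "('o, 'm) bialgebra \<Rightarrow> ('o, 'm) bialgebra \<Rightarrow> 'm" where
  "tensor_counit B R = mult_unit \<cdot> (Counit B \<boxtimes> Counit R)"

definition left_action :: "'o \<Rightarrow> 'm \<Rightarrow> 'm \<Rightarrow> 'o \<Rightarrow> 'm \<Rightarrow> bool" where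
  "left_action X m u M act \<longleftrightarrow>
     act \<in> Hom C (X \<otimes> M) M \<and>
     act \<cdot> (m \<boxtimes> id M) = act \<cdot> (id X \<boxtimes> act) \<cdot> \<a> X X M \<and>
     act \<cdot> (u \<boxtimes> id M) = \<l> M"

definition right_action :: "'o \<Rightarrow> 'm \<Rightarrow> 'm \<Rightarrow> 'o \<Rightarrow> 'm \<Rightarrow> bool" where
  "right_action X m u M act \<longleftrightarrow>
     act \<in> Hom C (M \<otimes> X) M \<and>
     act \<cdot> (act \<boxtimes> id X) = act \<cdot> (id M \<boxtimes> m) \<cdot> \<a> M X X \<and>
     act \<cdot> (id M \<boxtimes> u) = \<r> M"

definition left_module_coalgebra :: "('o, 'm) bialgebra \<Rightarrow> ('o, 'm) bialgebra \<Rightarrow> 'm \<Rightarrow> bool" where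
  "left_module_coalgebra B R act \<longleftrightarrow>
     is_coalgebra (Carrier R) (Comult R) (Counit R) \<and>
     left_action (Carrier B) (Mult B) (Unit B) (Carrier R) act \<and>
     coalgebra_hom (Carrier B \<otimes> Carrier R) (tensor_comult B R) (tensor_counit B R)
       (Carrier R) (Comult R) (Counit R) act"

definition right_module_coalgebra :: "('o, 'm) bialgebra \<Rightarrow> ('o, 'm) bialgebra \<Rightarrow> 'm \<Rightarrow> bool" where
  "right_module_coalgebra R B act \<longleftrightarrow>
     is_coalgebra (Carrier B) (Comult B) (Counit B) \<and>
     right_action (Carrier R) (Mult R) (Unit R) (Carrier B) act \<and>
     coalgebra_hom (Carrier B \<otimes> Carrier R) (tensor_comult B R) (tensor_counit B R)
       (Carrier B) (Comult B) (Counit B) act"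

definition matched_pair ::
    "('o, 'm) bialgebra \<Rightarrow> ('o, 'm) bialgebra \<Rightarrow> 'm \<Rightarrow> 'm \<Rightarrow> bool" where
  "matched_pair R B la ra \<longleftrightarrow>
     (let r = Carrier R; b = Carrier B in
       is_bialgebra R \<and> is_bialgebra B \<and>
       left_module_coalgebra B R la \<and>
       right_module_coalgebra R B ra \<and>
       ra \<cdot> (Unit B \<boxtimes> id r) = Unit B \<cdot> Counit R \<cdot> \<l> r \<and>
       la \<cdot> (id b \<boxtimes> Unit R) = Unit R \<cdot> Counit B \<cdot> \<r> b \<and>
       Mult B \<cdot> (ra \<boxtimes> id b) \<cdot> inv (\<a> b r b) \<cdot> (id b \<boxtimes> (la \<boxtimes> ra))
           \<cdot> (id b \<boxtimes> tensor_comult B R) \<cdot> \<a> b b r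
         = ra \<cdot> (Mult B \<boxtimes> id r) \<and>
       Mult R \<cdot> (id r \<boxtimes> la) \<cdot> \<a> r b r \<cdot> ((la \<boxtimes> ra) \<boxtimes> id r)
           \<cdot> (tensor_comult B R \<boxtimes> id r) \<cdot> inv (\<a> b r r)
         = la \<cdot> (id b \<boxtimes> Mult R) \<and>
       (ra \<boxtimes> la) \<cdot> tensor_comult B R = \<c> r b \<cdot> (la \<boxtimes> ra) \<cdot> tensor_comult B R)"

definition double_cross_product ::
    "('o, 'm) bialgebra \<Rightarrow> ('o, 'm) bialgebra \<Rightarrow> 'm \<Rightarrow> 'm \<Rightarrow> ('o, 'm) bialgebra" where
  "double_cross_product R B la ra =
     (let r = Carrier R; b = Carrier B in
       \<lparr> Carrier = r \<otimes> b,
         Mult = (Mult R \<boxtimes> Mult B) \<cdot> inv (rebracket r r b b)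
           \<cdot> (id r \<boxtimes> ((la \<boxtimes> ra) \<boxtimes> id b))
           \<cdot> (id r \<boxtimes> (middle_braid b b r r \<boxtimes> id b))
           \<cdot> (id r \<boxtimes> ((Comult B \<boxtimes> Comult R) \<boxtimes> id b))
           \<cdot> rebracket r b r b,
         Unit = (Unit R \<boxtimes> Unit B) \<cdot> comult_unit,
         Comult = middle_braid r r b b \<cdot> (Comult R \<boxtimes> Comult B),
         Counit = mult_unit \<cdot> (Counit R \<boxtimes> Counit B) \<rparr>)"

end

end

theory Submission
  imports Defs
begin

text \<open>
  Everything is carried by the exchange map \<open>\<Psi> : B \<otimes> R \<rightarrow> R \<otimes> B\<close>, characterised by
  \<open>\<Phi> \<cdot> \<Psi> = \<Theta>\<close>. Heuristically it rewrites a product \<open>\<sigma>(x) i(y)\<close> in \<open>A\<close> in the form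
  \<open>\<Sum> i(y') \<sigma>(x')\<close>. Two independent facts about it are needed.

  Since \<open>A\<close> is associative and \<open>\<sigma>\<close>, \<open>i\<close> are algebra morphisms, \<open>\<Psi>\<close> is a distributive law: a product
  in \<open>B\<close> or in \<open>R\<close> can be moved past the other factor one step at a time (\<open>\<Psi>_mult_B\<close>, \<open>\<Psi>_mult_R\<close>,
  and \<open>\<Psi>_unit_B\<close>, \<open>\<Psi>_unit_R\<close> for units). To prove such an equation it suffices to compose
  with the monomorphism \<open>\<Phi>\<close>, after which both sides are the same product of copies of
  \<open>\<sigma>\<close> and \<open>i\<close> in \<open>A\<close>, bracketed differently.

  Since the multiplication of \<open>A\<close> is a coalgebra morphism, so are \<open>\<Phi>\<close> and \<open>\<Theta>\<close>, and hence
  \<open>\<Psi>\<close>. The actions are \<open>\<Psi>\<close> followed by the two projections \<open>onto_R\<close> and \<open>onto_B\<close> of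
  \<open>R \<otimes> B\<close>, which are coalgebra morphisms themselves and recover the identity and the
  braiding when they are paired along the comultiplication (\<open>onto_R_onto_B\<close>,
  \<open>onto_B_onto_R\<close>). Thus the actions are coalgebra morphisms, \<open>\<Psi>\<close> is the pairing of the
  two actions (\<open>left_act_right_act\<close>), and the opposite pairing is the braiding applied to \<open>\<Psi>\<close>
  (\<open>right_act_left_act\<close>), which is the last axiom of a matched pair. The module axioms and the two
  multiplicative compatibilities are obtained by projecting the distributive law to \<open>R\<close> and
  to \<open>B\<close>.

  Finally the multiplication of the double cross product is built from \<open>\<Psi>\<close>, so \<open>\<Phi>\<close> carries it to the
  multiplication of \<open>A\<close> (\<open>\<Phi>_cross_mult\<close>). The bialgebra axioms of the double cross product
  are then transported from \<open>A\<close> along the isomorphism \<open>\<Phi>\<close> (\<open>bialgebra_transport\<close>).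

  The category is not strict. Associators are controlled by naturality, by Kelly's unit identities,
  and by the values of the middle braiding \<open>(W \<otimes> X) \<otimes> (Y \<otimes> Z) \<rightarrow> (W \<otimes> Y) \<otimes> (X \<otimes> Z)\<close> when two
  arguments are the unit object.
\<close>

section \<open>Categories\<close>

context category
begin

text \<open>
  Hypotheses of the form \<open>f \<in> Hom C X Y\<close> mention objects that a rewrite rule cannot infer from
  its left-hand side. The axioms are therefore restated with \<open>Arr\<close>, \<open>Dom\<close> and \<open>Cod\<close>, whose
  values the simplifier computes.
\<close>

lemma in_hom_iff [simp]: "f \<in> Hom C X Y \<longleftrightarrow> f \<in> Arr C \<and> Dom C f = X \<and> Cod C f = Y"
  by (auto simp: Hom_def)

lemma id_arr [simp]:
  assumes "X \<in> Obj C"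
  shows "id X \<in> Arr C" "Dom C (id X) = X" "Cod C (id X) = X"
  using id_in_hom[OF assms] by auto

lemma comp_arr [simp]:
  assumes "f \<in> Arr C" "g \<in> Arr C" "Cod C f = Dom C g"
  shows "g \<cdot> f \<in> Arr C" "Dom C (g \<cdot> f) = Dom C f" "Cod C (g \<cdot> f) = Cod C g"
  using comp_in_hom[of f "Dom C f" "Dom C g" g "Cod C g"] assms by auto

lemma dom_cod_obj [simp]:
  assumes "f \<in> Arr C"
  shows "Dom C f \<in> Obj C" "Cod C f \<in> Obj C"
  using assms Dom_in_Obj Cod_in_Obj by auto

lemma id_comp_arr [simp]: "f \<in> Arr C \<Longrightarrow> Cod C f = Y \<Longrightarrow> id Y \<cdot> f = f"
  using id_comp by auto

lemma comp_id_arr [simp]: "f \<in> Arr C \<Longrightarrow> Dom C f = X \<Longrightarrow> f \<cdot> id X = f"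
  using comp_id by auto

lemma comp_assoc_arr [simp]:
  "\<lbrakk>f \<in> Arr C; g \<in> Arr C; h \<in> Arr C; Cod C f = Dom C g; Cod C g = Dom C h\<rbrakk>
    \<Longrightarrow> (h \<cdot> g) \<cdot> f = h \<cdot> (g \<cdot> f)"
  using comp_assoc[of f "Dom C f" "Dom C g" g "Dom C h" h "Cod C h"] by auto

text \<open>
  Composites are kept associated to the right; this form of an equation rewrites a factor
  pair that is followed by a further arrow.
\<close>

lemma comp_extend:
  assumes "g \<cdot> f = h"
    and "f \<in> Arr C" "g \<in> Arr C" "x \<in> Arr C" "Cod C x = Dom C f" "Cod C f = Dom C g"
  shows "g \<cdot> (f \<cdot> x) = h \<cdot> x"
  using assms comp_assoc_arr[of x f g] by simp

lemma inverse_arrows_unique: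
  assumes "inverse_arrows C f g" "inverse_arrows C f h"
  shows "g = h"
proof -
  have "g = g \<cdot> (f \<cdot> h)" using assms by (simp add: inverse_arrows_def)
  also have "\<dots> = (g \<cdot> f) \<cdot> h"
    using assms by (intro comp_assoc_arr[symmetric]) (auto simp: inverse_arrows_def)
  also have "\<dots> = h" using assms by (auto simp: inverse_arrows_def)
  finally show ?thesis .
qed

lemma inverse_arrows_inv: "is_iso C f \<Longrightarrow> inverse_arrows C f (inv f)"
  unfolding is_iso_def inv_arr_def
  by (metis inverse_arrows_unique theI)

lemma inv_arrows [simp]:
  assumes "is_iso C f"
  shows "inv f \<in> Arr C" "Dom C (inv f) = Cod C f" "Cod C (inv f) = Dom C f"
    and "inv f \<cdot> f = id (Dom C f)" "f \<cdot> inv f = id (Cod C f)"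
  using inverse_arrows_inv[OF assms] by (auto simp: inverse_arrows_def)

lemma iso_arr: "is_iso C f \<Longrightarrow> f \<in> Arr C"
  by (auto simp: is_iso_def inverse_arrows_def)

lemma inv_comp_cancel [simp]:
  assumes "is_iso C f" "x \<in> Arr C"
  shows "Cod C x = Dom C f \<Longrightarrow> inv f \<cdot> (f \<cdot> x) = x"
    and "Cod C x = Cod C f \<Longrightarrow> f \<cdot> (inv f \<cdot> x) = x"
  using assms iso_arr[OF assms(1)]
  by (simp_all only: comp_assoc_arr[symmetric] inv_arrows id_comp_arr)

lemma isoI:
  assumes "f \<in> Hom C X Y" "g \<in> Hom C Y X" "g \<cdot> f = id X" "f \<cdot> g = id Y"
  shows "is_iso C f" "inv f = g"
proof -
  have "inverse_arrows C f g" using assms by (auto simp: inverse_arrows_def)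
  then show "is_iso C f" "inv f = g"
    using inverse_arrows_unique inverse_arrows_inv unfolding is_iso_def by blast+
qed

lemma iso_inv: "is_iso C f \<Longrightarrow> is_iso C (inv f)"
  by (rule isoI(1)[of _ "Cod C f" "Dom C f" f]) (auto simp: iso_arr)

lemma iso_comp:
  assumes "is_iso C f" "is_iso C g" "Cod C f = Dom C g"
  shows "is_iso C (g \<cdot> f)"
  by (rule isoI(1)[of _ "Dom C f" "Cod C g" "inv f \<cdot> inv g"]) (use assms iso_arr in auto)

lemma iso_monic:
  assumes "is_iso C f" "f \<cdot> g = f \<cdot> h"
    and "g \<in> Arr C" "Cod C g = Dom C f" "h \<in> Arr C" "Cod C h = Dom C f"
  shows "g = h"
  using inv_comp_cancel(1)[OF assms(1,3,4)] inv_comp_cancel(1)[OF assms(1,5,6)] assms(2) by metis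

lemma iso_epic:
  assumes "is_iso C f" "g \<cdot> f = h \<cdot> f"
    and "g \<in> Arr C" "Dom C g = Cod C f" "h \<in> Arr C" "Dom C h = Cod C f"
  shows "g = h"
proof -
  have "(g \<cdot> f) \<cdot> inv f = g" "(h \<cdot> f) \<cdot> inv f = h"
    using assms(1,3-) iso_arr[OF assms(1)] by simp_all
  with assms(2) show ?thesis by metis
qed

lemma iso_square:
  assumes "is_iso C p" "is_iso C q" "q \<cdot> f = g \<cdot> p"
    and "f \<in> Arr C" "g \<in> Arr C" "Dom C f = Dom C p" "Cod C f = Dom C q"
      "Dom C g = Cod C p" "Cod C g = Cod C q"
  shows "inv q \<cdot> g = f \<cdot> inv p"
proof -
  have "inv q \<cdot> g = inv q \<cdot> ((g \<cdot> p) \<cdot> inv p)" using assms(1,2,4-) iso_arr by simp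
  also have "\<dots> = inv q \<cdot> ((q \<cdot> f) \<cdot> inv p)" using assms(3) by simp
  also have "\<dots> = f \<cdot> inv p" using assms(1,2,4-) iso_arr by simp
  finally show ?thesis .
qed

end

section \<open>Coherence for units in a monoidal category\<close>

context monoidal_category
begin

lemma unit_obj [simp]: "\<one> \<in> Obj C"
  by (rule unit_in_Obj)

lemma tensor_obj [simp]: "X \<in> Obj C \<Longrightarrow> Y \<in> Obj C \<Longrightarrow> X \<otimes> Y \<in> Obj C"
  by (rule tensor_in_Obj)

lemma tensor_arr [simp]:
  assumes "f \<in> Arr C" "g \<in> Arr C"
  shows "f \<boxtimes> g \<in> Arr C" "Dom C (f \<boxtimes> g) = Dom C f \<otimes> Dom C g"
    "Cod C (f \<boxtimes> g) = Cod C f \<otimes> Cod C g"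
  using tensor_in_hom[of f "Dom C f" "Cod C f" g "Dom C g" "Cod C g"] assms by auto

lemma interchange [simp]:
  assumes "f \<in> Arr C" "f' \<in> Arr C" "g \<in> Arr C" "g' \<in> Arr C"
    "Cod C f = Dom C f'" "Cod C g = Dom C g'"
  shows "(f' \<boxtimes> g') \<cdot> (f \<boxtimes> g) = (f' \<cdot> f) \<boxtimes> (g' \<cdot> g)"
  using tensor_comp[of f "Dom C f" "Dom C f'" f' "Cod C f'" g "Dom C g" "Dom C g'" g' "Cod C g'"]
    assms by auto

lemma interchange_extend [simp]:
  assumes "f \<in> Arr C" "f' \<in> Arr C" "g \<in> Arr C" "g' \<in> Arr C"
    "Cod C f = Dom C f'" "Cod C g = Dom C g'" "x \<in> Arr C" "Cod C x = Dom C f \<otimes> Dom C g"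
  shows "(f' \<boxtimes> g') \<cdot> ((f \<boxtimes> g) \<cdot> x) = ((f' \<cdot> f) \<boxtimes> (g' \<cdot> g)) \<cdot> x"
  using assms by (intro comp_extend) auto

lemma tensor_id_id [simp]: "X \<in> Obj C \<Longrightarrow> Y \<in> Obj C \<Longrightarrow> id X \<boxtimes> id Y = id (X \<otimes> Y)"
  by (rule tensor_id)

lemma assoc_arr [simp]:
  assumes "X \<in> Obj C" "Y \<in> Obj C" "Z \<in> Obj C"
  shows "\<a> X Y Z \<in> Arr C" "Dom C (\<a> X Y Z) = (X \<otimes> Y) \<otimes> Z"
    "Cod C (\<a> X Y Z) = X \<otimes> (Y \<otimes> Z)" "is_iso C (\<a> X Y Z)"
  using assoc_in_hom[OF assms] assoc_iso[OF assms] by auto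

lemma lunit_arr [simp]:
  assumes "X \<in> Obj C"
  shows "\<l> X \<in> Arr C" "Dom C (\<l> X) = \<one> \<otimes> X" "Cod C (\<l> X) = X" "is_iso C (\<l> X)"
  using lunit_in_hom[OF assms] lunit_iso[OF assms] by auto

lemma runit_arr [simp]:
  assumes "X \<in> Obj C"
  shows "\<r> X \<in> Arr C" "Dom C (\<r> X) = X \<otimes> \<one>" "Cod C (\<r> X) = X" "is_iso C (\<r> X)"
  using runit_in_hom[OF assms] runit_iso[OF assms] by auto

lemma iso_tensor [simp]:
  assumes "is_iso C f" "is_iso C g"
  shows "is_iso C (f \<boxtimes> g)" "inv (f \<boxtimes> g) = inv f \<boxtimes> inv g"
  using isoI[of "f \<boxtimes> g" "Dom C f \<otimes> Dom C g" "Cod C f \<otimes> Cod C g" "inv f \<boxtimes> inv g"] assms iso_arr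
  by auto

lemma iso_id [simp]:
  assumes "X \<in> Obj C"
  shows "is_iso C (id X)" "inv (id X) = id X"
  using isoI[of "id X" X X "id X"] assms by auto

lemma assoc_nat:
  assumes "f \<in> Arr C" "g \<in> Arr C" "h \<in> Arr C"
    "Cod C f = X" "Cod C g = Y" "Cod C h = Z"
  shows "\<a> X Y Z \<cdot> ((f \<boxtimes> g) \<boxtimes> h)
    = (f \<boxtimes> (g \<boxtimes> h)) \<cdot> \<a> (Dom C f) (Dom C g) (Dom C h)"
  using assoc_natural[of f "Dom C f" X g "Dom C g" Y h "Dom C h" Z] assms by auto

lemmas assoc_nat_extend = comp_extend[OF assoc_nat]

lemma inv_assoc_nat:
  assumes "f \<in> Arr C" "g \<in> Arr C" "h \<in> Arr C"
    "Cod C f = X" "Cod C g = Y" "Cod C h = Z"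
  shows "inv (\<a> X Y Z) \<cdot> (f \<boxtimes> (g \<boxtimes> h))
    = ((f \<boxtimes> g) \<boxtimes> h) \<cdot> inv (\<a> (Dom C f) (Dom C g) (Dom C h))"
  by (rule iso_square) (use assms assoc_nat[OF assms] in auto)

lemma lunit_nat: "f \<in> Arr C \<Longrightarrow> Cod C f = Y \<Longrightarrow> \<l> Y \<cdot> (id \<one> \<boxtimes> f) = f \<cdot> \<l> (Dom C f)"
  using lunit_natural by auto

lemma runit_nat: "f \<in> Arr C \<Longrightarrow> Cod C f = Y \<Longrightarrow> \<r> Y \<cdot> (f \<boxtimes> id \<one>) = f \<cdot> \<r> (Dom C f)"
  using runit_natural by auto

lemma unit_tensor_faithful:
  assumes "id \<one> \<boxtimes> f = id \<one> \<boxtimes> g"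
    and "f \<in> Arr C" "g \<in> Arr C" "Dom C f = Dom C g" "Cod C f = Cod C g"
  shows "f = g"
proof (rule iso_epic[of "\<l> (Dom C f)"])
  show "f \<cdot> \<l> (Dom C f) = g \<cdot> \<l> (Dom C f)"
    using lunit_nat[of f "Cod C f"] lunit_nat[of g "Cod C g"] assms by simp
qed (use assms in auto)

lemma tensor_unit_faithful:
  assumes "f \<boxtimes> id \<one> = g \<boxtimes> id \<one>"
    and "f \<in> Arr C" "g \<in> Arr C" "Dom C f = Dom C g" "Cod C f = Cod C g"
  shows "f = g"
proof (rule iso_epic[of "\<r> (Dom C f)"])
  show "f \<cdot> \<r> (Dom C f) = g \<cdot> \<r> (Dom C f)"
    using runit_nat[of f "Cod C f"] runit_nat[of g "Cod C g"] assms by simp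
qed (use assms in auto)

text \<open>
  Kelly's identity: after tensoring with \<open>\<one>\<close>, which is faithful, it is the pentagon for
  \<open>\<one>, \<one>, X, Y\<close> with both occurrences of \<open>\<a> \<one> \<one> _\<close> absorbed by triangles.
\<close>

lemma lunit_tensor:
  assumes X: "X \<in> Obj C" and Y: "Y \<in> Obj C"
  shows "\<l> (X \<otimes> Y) \<cdot> \<a> \<one> X Y = \<l> X \<boxtimes> id Y"
proof (rule unit_tensor_faithful, rule iso_epic[of "\<a> \<one> (\<one> \<otimes> X) Y \<cdot> (\<a> \<one> \<one> X \<boxtimes> id Y)"])
  have "(id \<one> \<boxtimes> (\<l> (X \<otimes> Y) \<cdot> \<a> \<one> X Y)) \<cdot> \<a> \<one> (\<one> \<otimes> X) Y \<cdot> (\<a> \<one> \<one> X \<boxtimes> id Y)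
      = (id \<one> \<boxtimes> \<l> (X \<otimes> Y)) \<cdot> (id \<one> \<boxtimes> \<a> \<one> X Y) \<cdot> \<a> \<one> (\<one> \<otimes> X) Y \<cdot> (\<a> \<one> \<one> X \<boxtimes> id Y)"
    using X Y by simp
  also have "\<dots> = (id \<one> \<boxtimes> \<l> (X \<otimes> Y)) \<cdot> \<a> \<one> \<one> (X \<otimes> Y) \<cdot> \<a> (\<one> \<otimes> \<one>) X Y"
    using X Y by (simp only: pentagon unit_obj)
  also have "\<dots> = (\<r> \<one> \<boxtimes> id (X \<otimes> Y)) \<cdot> \<a> (\<one> \<otimes> \<one>) X Y"
    using X Y by (simp add: comp_extend[OF triangle])
  also have "\<dots> = \<a> \<one> X Y \<cdot> ((\<r> \<one> \<boxtimes> id X) \<boxtimes> id Y)"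
    using X Y by (simp add: assoc_nat)
  also have "\<dots> = \<a> \<one> X Y \<cdot> (((id \<one> \<boxtimes> \<l> X) \<cdot> \<a> \<one> \<one> X) \<boxtimes> id Y)"
    using X by (simp only: triangle unit_obj)
  also have "\<dots> = \<a> \<one> X Y \<cdot> ((id \<one> \<boxtimes> \<l> X) \<boxtimes> id Y) \<cdot> (\<a> \<one> \<one> X \<boxtimes> id Y)"
    using X Y by simp
  also have "\<dots> = (id \<one> \<boxtimes> (\<l> X \<boxtimes> id Y)) \<cdot> \<a> \<one> (\<one> \<otimes> X) Y \<cdot> (\<a> \<one> \<one> X \<boxtimes> id Y)"
    using X Y by (simp add: assoc_nat_extend del: interchange interchange_extend)
  finally show "(id \<one> \<boxtimes> (\<l> (X \<otimes> Y) \<cdot> \<a> \<one> X Y)) \<cdot> \<a> \<one> (\<one> \<otimes> X) Y \<cdot> (\<a> \<one> \<one> X \<boxtimes> id Y)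
      = (id \<one> \<boxtimes> (\<l> X \<boxtimes> id Y)) \<cdot> \<a> \<one> (\<one> \<otimes> X) Y \<cdot> (\<a> \<one> \<one> X \<boxtimes> id Y)" .
qed (use X Y iso_comp in auto)

text \<open>
  The mirror image of the previous identity: after tensoring with \<open>\<one>\<close> on the right it is the pentagon
  for \<open>X, Y, \<one>, \<one>\<close>.
\<close>

lemma runit_tensor:
  assumes X: "X \<in> Obj C" and Y: "Y \<in> Obj C"
  shows "(id X \<boxtimes> \<r> Y) \<cdot> \<a> X Y \<one> = \<r> (X \<otimes> Y)"
proof (rule tensor_unit_faithful, rule iso_monic[of "\<a> X Y \<one>"])
  have "\<a> X Y \<one> \<cdot> (((id X \<boxtimes> \<r> Y) \<cdot> \<a> X Y \<one>) \<boxtimes> id \<one>)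
      = \<a> X Y \<one> \<cdot> ((id X \<boxtimes> \<r> Y) \<boxtimes> id \<one>) \<cdot> (\<a> X Y \<one> \<boxtimes> id \<one>)"
    using X Y by simp
  also have "\<dots> = (id X \<boxtimes> (\<r> Y \<boxtimes> id \<one>)) \<cdot> \<a> X (Y \<otimes> \<one>) \<one> \<cdot> (\<a> X Y \<one> \<boxtimes> id \<one>)"
    using X Y by (simp add: assoc_nat_extend del: interchange interchange_extend)
  also have "\<dots> = (id X \<boxtimes> ((id Y \<boxtimes> \<l> \<one>) \<cdot> \<a> Y \<one> \<one>)) \<cdot> \<a> X (Y \<otimes> \<one>) \<one> \<cdot> (\<a> X Y \<one> \<boxtimes> id \<one>)"
    using X Y by (simp only: triangle unit_obj)
  also have "\<dots> = (id X \<boxtimes> (id Y \<boxtimes> \<l> \<one>)) \<cdot> (id X \<boxtimes> \<a> Y \<one> \<one>) \<cdot> \<a> X (Y \<otimes> \<one>) \<one> \<cdot> (\<a> X Y \<one> \<boxtimes> id \<one>)"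
    using X Y by simp
  also have "\<dots> = (id X \<boxtimes> (id Y \<boxtimes> \<l> \<one>)) \<cdot> \<a> X Y (\<one> \<otimes> \<one>) \<cdot> \<a> (X \<otimes> Y) \<one> \<one>"
    using X Y by (simp only: pentagon unit_obj)
  also have "\<dots> = (\<a> X Y \<one> \<cdot> ((id X \<boxtimes> id Y) \<boxtimes> \<l> \<one>)) \<cdot> \<a> (X \<otimes> Y) \<one> \<one>"
    using X Y by (simp add: assoc_nat del: tensor_id_id)
  also have "\<dots> = \<a> X Y \<one> \<cdot> (\<r> (X \<otimes> Y) \<boxtimes> id \<one>)"
    using X Y by (simp add: triangle)
  finally show "\<a> X Y \<one> \<cdot> (((id X \<boxtimes> \<r> Y) \<cdot> \<a> X Y \<one>) \<boxtimes> id \<one>) = \<a> X Y \<one> \<cdot> (\<r> (X \<otimes> Y) \<boxtimes> id \<one>)" .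
qed (use X Y in auto)

lemma lunit_unit_tensor: "X \<in> Obj C \<Longrightarrow> \<l> (\<one> \<otimes> X) = id \<one> \<boxtimes> \<l> X"
  by (rule iso_monic[of "\<l> X"]) (auto simp: lunit_nat)

lemma runit_tensor_unit: "X \<in> Obj C \<Longrightarrow> \<r> (X \<otimes> \<one>) = \<r> X \<boxtimes> id \<one>"
  by (rule iso_monic[of "\<r> X"]) (auto simp: runit_nat)

text \<open>
  Kelly's identity and the triangle express \<open>\<l> \<one> \<boxtimes> id \<one>\<close> and \<open>\<r> \<one> \<boxtimes> id \<one>\<close> by the same composite,
  because \<open>\<l> (\<one> \<otimes> \<one>) = id \<one> \<boxtimes> \<l> \<one>\<close>.
\<close>

lemma lunit_eq_runit: "\<r> \<one> = \<l> \<one>"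
proof (rule tensor_unit_faithful)
  show "\<r> \<one> \<boxtimes> id \<one> = \<l> \<one> \<boxtimes> id \<one>"
    by (simp add: lunit_tensor[symmetric] triangle[symmetric] lunit_unit_tensor)
qed auto

lemma lunit_inv_assoc:
  assumes "X \<in> Obj C" "Y \<in> Obj C"
  shows "(\<l> X \<boxtimes> id Y) \<cdot> inv (\<a> \<one> X Y) = \<l> (X \<otimes> Y)"
  using assms by (simp add: lunit_tensor[symmetric])

lemma runit_inv_assoc:
  assumes "X \<in> Obj C" "Y \<in> Obj C"
  shows "\<r> (X \<otimes> Y) \<cdot> inv (\<a> X Y \<one>) = id X \<boxtimes> \<r> Y"
  using assms by (simp add: runit_tensor[symmetric])

lemma triangle_inv_assoc:
  assumes "X \<in> Obj C" "Y \<in> Obj C"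
  shows "(\<r> X \<boxtimes> id Y) \<cdot> inv (\<a> X \<one> Y) = id X \<boxtimes> \<l> Y"
  using assms by (simp add: triangle[symmetric])

end


section \<open>The braiding and the unit object\<close>

context braided_monoidal_category
begin

lemma braid_arr [simp]:
  assumes "X \<in> Obj C" "Y \<in> Obj C"
  shows "\<c> X Y \<in> Arr C" "Dom C (\<c> X Y) = X \<otimes> Y" "Cod C (\<c> X Y) = Y \<otimes> X" "is_iso C (\<c> X Y)"
  using braid_in_hom[OF assms] braid_iso[OF assms] by auto

lemma braid_nat:
  assumes "f \<in> Arr C" "g \<in> Arr C" "Cod C f = X" "Cod C g = Y"
  shows "\<c> X Y \<cdot> (f \<boxtimes> g) = (g \<boxtimes> f) \<cdot> \<c> (Dom C f) (Dom C g)"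
  using braid_natural[of f "Dom C f" X g "Dom C g" Y] assms by auto

text \<open>
  Both sides become equal after tensoring with \<open>\<one>\<close> on the right and composing with an
  isomorphism: this is the hexagon for \<open>\<one>, \<one>, X\<close>, pushed along \<open>\<l> \<one> : \<one> \<otimes> \<one> \<rightarrow> \<one>\<close> by
  naturality.
\<close>

lemma runit_braid:
  assumes X: "X \<in> Obj C"
  shows "\<r> X \<cdot> \<c> \<one> X = \<l> X"
proof (rule tensor_unit_faithful,
    rule iso_epic[of "inv (\<a> \<one> X \<one>) \<cdot> (id \<one> \<boxtimes> \<c> \<one> X) \<cdot> \<a> \<one> \<one> X"])
  have "((\<r> X \<cdot> \<c> \<one> X) \<boxtimes> id \<one>) \<cdot> inv (\<a> \<one> X \<one>) \<cdot> (id \<one> \<boxtimes> \<c> \<one> X) \<cdot> \<a> \<one> \<one> X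
      = (\<r> X \<boxtimes> id \<one>) \<cdot> (\<c> \<one> X \<boxtimes> id \<one>) \<cdot> inv (\<a> \<one> X \<one>) \<cdot> (id \<one> \<boxtimes> \<c> \<one> X) \<cdot> \<a> \<one> \<one> X"
    using X by simp
  also have "\<dots> = (id X \<boxtimes> \<l> \<one>) \<cdot> \<c> (\<one> \<otimes> \<one>) X"
    using X by (simp add: triangle[symmetric] hexagon_left del: interchange interchange_extend)
  also have "\<dots> = \<c> \<one> X \<cdot> (\<r> \<one> \<boxtimes> id X)"
    using X by (simp add: braid_nat lunit_eq_runit)
  also have "\<dots> = (\<c> \<one> X \<cdot> \<l> (\<one> \<otimes> X)) \<cdot> \<a> \<one> \<one> X"
    using X by (simp add: triangle[symmetric] lunit_unit_tensor)
  also have "\<dots> = \<l> (X \<otimes> \<one>) \<cdot> (id \<one> \<boxtimes> \<c> \<one> X) \<cdot> \<a> \<one> \<one> X"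
    using X by (simp add: comp_extend[OF lunit_nat])
  also have "\<dots> = (\<l> X \<boxtimes> id \<one>) \<cdot> inv (\<a> \<one> X \<one>) \<cdot> (id \<one> \<boxtimes> \<c> \<one> X) \<cdot> \<a> \<one> \<one> X"
    using X by (simp add: lunit_inv_assoc[symmetric])
  finally show "((\<r> X \<cdot> \<c> \<one> X) \<boxtimes> id \<one>) \<cdot> inv (\<a> \<one> X \<one>) \<cdot> (id \<one> \<boxtimes> \<c> \<one> X) \<cdot> \<a> \<one> \<one> X
      = (\<l> X \<boxtimes> id \<one>) \<cdot> inv (\<a> \<one> X \<one>) \<cdot> (id \<one> \<boxtimes> \<c> \<one> X) \<cdot> \<a> \<one> \<one> X" .
qed (use X iso_inv iso_comp in auto)

text \<open>
  The same argument with the other hexagon, for \<open>X, \<one>, \<one>\<close>. Without symmetry of the braiding it does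
  not follow from the preceding lemma.
\<close>

lemma lunit_braid:
  assumes X: "X \<in> Obj C"
  shows "\<l> X \<cdot> \<c> X \<one> = \<r> X"
proof (rule unit_tensor_faithful,
    rule iso_epic[of "\<a> \<one> X \<one> \<cdot> (\<c> X \<one> \<boxtimes> id \<one>) \<cdot> inv (\<a> X \<one> \<one>)"])
  have "(id \<one> \<boxtimes> (\<l> X \<cdot> \<c> X \<one>)) \<cdot> \<a> \<one> X \<one> \<cdot> (\<c> X \<one> \<boxtimes> id \<one>) \<cdot> inv (\<a> X \<one> \<one>)
      = (id \<one> \<boxtimes> \<l> X) \<cdot> (id \<one> \<boxtimes> \<c> X \<one>) \<cdot> \<a> \<one> X \<one> \<cdot> (\<c> X \<one> \<boxtimes> id \<one>) \<cdot> inv (\<a> X \<one> \<one>)"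
    using X by simp
  also have "\<dots> = (\<l> \<one> \<boxtimes> id X) \<cdot> \<c> X (\<one> \<otimes> \<one>)"
    using X by (simp add: triangle_inv_assoc[symmetric] hexagon_right lunit_eq_runit[symmetric]
        del: interchange interchange_extend)
  also have "\<dots> = \<c> X \<one> \<cdot> (id X \<boxtimes> \<l> \<one>)"
    using X by (simp add: braid_nat)
  also have "\<dots> = (\<c> X \<one> \<cdot> \<r> (X \<otimes> \<one>)) \<cdot> inv (\<a> X \<one> \<one>)"
    using X by (simp add: triangle_inv_assoc[symmetric] runit_tensor_unit)
  also have "\<dots> = \<r> (\<one> \<otimes> X) \<cdot> (\<c> X \<one> \<boxtimes> id \<one>) \<cdot> inv (\<a> X \<one> \<one>)"
    using X by (simp add: comp_extend[OF runit_nat])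
  also have "\<dots> = (id \<one> \<boxtimes> \<r> X) \<cdot> \<a> \<one> X \<one> \<cdot> (\<c> X \<one> \<boxtimes> id \<one>) \<cdot> inv (\<a> X \<one> \<one>)"
    using X by (simp add: runit_tensor[symmetric])
  finally show "(id \<one> \<boxtimes> (\<l> X \<cdot> \<c> X \<one>)) \<cdot> \<a> \<one> X \<one> \<cdot> (\<c> X \<one> \<boxtimes> id \<one>) \<cdot> inv (\<a> X \<one> \<one>)
      = (id \<one> \<boxtimes> \<r> X) \<cdot> \<a> \<one> X \<one> \<cdot> (\<c> X \<one> \<boxtimes> id \<one>) \<cdot> inv (\<a> X \<one> \<one>)" .
qed (use X iso_inv iso_comp in auto)

lemma braid_unit_unit: "\<c> \<one> \<one> = id (\<one> \<otimes> \<one>)"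
  by (rule iso_monic[of "\<l> \<one>"]) (auto simp: lunit_braid lunit_eq_runit)


section \<open>The middle braiding\<close>

lemma rebracket_arr [simp]:
  assumes "W \<in> Obj C" "X \<in> Obj C" "Y \<in> Obj C" "Z \<in> Obj C"
  shows "rebracket C W X Y Z \<in> Arr C"
    "Dom C (rebracket C W X Y Z) = (W \<otimes> X) \<otimes> (Y \<otimes> Z)"
    "Cod C (rebracket C W X Y Z) = W \<otimes> ((X \<otimes> Y) \<otimes> Z)"
    "is_iso C (rebracket C W X Y Z)"
  unfolding rebracket_def using assms by (auto intro!: iso_comp iso_tensor(1) iso_inv)

lemma rebracket_nat:
  assumes "f \<in> Arr C" "g \<in> Arr C" "h \<in> Arr C" "k \<in> Arr C"
    "Cod C f = W" "Cod C g = X" "Cod C h = Y" "Cod C k = Z"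
  shows "rebracket C W X Y Z \<cdot> ((f \<boxtimes> g) \<boxtimes> (h \<boxtimes> k))
    = (f \<boxtimes> ((g \<boxtimes> h) \<boxtimes> k)) \<cdot> rebracket C (Dom C f) (Dom C g) (Dom C h) (Dom C k)"
  unfolding rebracket_def using assms
  by (auto simp: assoc_nat inv_assoc_nat)

lemma middle_braid_arr [simp]:
  assumes "W \<in> Obj C" "X \<in> Obj C" "Y \<in> Obj C" "Z \<in> Obj C"
  shows "middle_braid C W X Y Z \<in> Arr C"
    "Dom C (middle_braid C W X Y Z) = (W \<otimes> X) \<otimes> (Y \<otimes> Z)"
    "Cod C (middle_braid C W X Y Z) = (W \<otimes> Y) \<otimes> (X \<otimes> Z)"
  unfolding middle_braid_def using assms by auto

text \<open>
  The form in which the middle braiding is computed with: composing with the isomorphism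
  \<open>rebracket\<close> removes the inverse from its definition.
\<close>

lemma rebracket_middle_braid:
  assumes "W \<in> Obj C" "X \<in> Obj C" "Y \<in> Obj C" "Z \<in> Obj C"
  shows "rebracket C W Y X Z \<cdot> middle_braid C W X Y Z
    = (id W \<boxtimes> (\<c> X Y \<boxtimes> id Z)) \<cdot> rebracket C W X Y Z"
  unfolding middle_braid_def using assms by auto

lemma middle_braid_nat:
  assumes "f \<in> Arr C" "g \<in> Arr C" "h \<in> Arr C" "k \<in> Arr C"
    "Cod C f = W" "Cod C g = X" "Cod C h = Y" "Cod C k = Z"
  shows "middle_braid C W X Y Z \<cdot> ((f \<boxtimes> g) \<boxtimes> (h \<boxtimes> k))
    = ((f \<boxtimes> h) \<boxtimes> (g \<boxtimes> k)) \<cdot> middle_braid C (Dom C f) (Dom C g) (Dom C h) (Dom C k)"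
proof (rule iso_monic[of "rebracket C W Y X Z"])
  let ?\<rho> = "rebracket C (Dom C f) (Dom C g) (Dom C h) (Dom C k)"
  have "rebracket C W Y X Z \<cdot> middle_braid C W X Y Z \<cdot> ((f \<boxtimes> g) \<boxtimes> (h \<boxtimes> k))
      = (f \<boxtimes> ((\<c> X Y \<cdot> (g \<boxtimes> h)) \<boxtimes> k)) \<cdot> ?\<rho>"
    using assms by (auto simp: comp_extend[OF rebracket_middle_braid] rebracket_nat)
  also have "\<dots> = (f \<boxtimes> ((h \<boxtimes> g) \<boxtimes> k)) \<cdot> (id (Dom C f) \<boxtimes> (\<c> (Dom C g) (Dom C h) \<boxtimes> id (Dom C k))) \<cdot> ?\<rho>"
    using assms by (auto simp: braid_nat)
  also have "\<dots> = rebracket C W Y X Z \<cdot> ((f \<boxtimes> h) \<boxtimes> (g \<boxtimes> k))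
      \<cdot> middle_braid C (Dom C f) (Dom C g) (Dom C h) (Dom C k)"
    using assms
    by (auto simp: comp_extend[OF rebracket_nat] rebracket_middle_braid
        simp del: interchange interchange_extend)
  finally show "rebracket C W Y X Z \<cdot> middle_braid C W X Y Z \<cdot> ((f \<boxtimes> g) \<boxtimes> (h \<boxtimes> k)) = \<dots>" .
qed (use assms in auto)

text \<open>
  When two of its four arguments are \<open>\<one>\<close>, the middle braiding is determined by the unit
  constraints. These identities are what applying two counits to a comultiplication of a
  tensor product leaves to be computed.
\<close>

lemma middle_braid_units_inside:
  assumes "W \<in> Obj C" "Z \<in> Obj C"
  shows "middle_braid C W \<one> \<one> Z = id ((W \<otimes> \<one>) \<otimes> (\<one> \<otimes> Z))"
  using assms by (auto simp: middle_braid_def braid_unit_unit)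

lemma units_outside_rebracket:
  assumes "X \<in> Obj C" "Y \<in> Obj C"
  shows "\<l> (X \<otimes> Y) \<cdot> (id \<one> \<boxtimes> \<r> (X \<otimes> Y)) \<cdot> rebracket C \<one> X Y \<one> = \<l> X \<boxtimes> \<r> Y"
proof -
  have "\<l> (X \<otimes> Y) \<cdot> (id \<one> \<boxtimes> \<r> (X \<otimes> Y)) \<cdot> rebracket C \<one> X Y \<one>
      = \<l> (X \<otimes> Y) \<cdot> (id \<one> \<boxtimes> (id X \<boxtimes> \<r> Y)) \<cdot> \<a> \<one> X (Y \<otimes> \<one>)"
    using assms by (simp add: rebracket_def runit_inv_assoc)
  also have "\<dots> = (\<l> (X \<otimes> Y) \<cdot> \<a> \<one> X Y) \<cdot> ((id \<one> \<boxtimes> id X) \<boxtimes> \<r> Y)"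
    using assms by (simp add: assoc_nat del: tensor_id_id)
  also have "\<dots> = \<l> X \<boxtimes> \<r> Y"
    using assms by (simp add: lunit_tensor del: comp_assoc_arr)
  finally show ?thesis .
qed

lemma middle_braid_units_outside:
  assumes "X \<in> Obj C" "Y \<in> Obj C"
  shows "(\<l> Y \<boxtimes> \<r> X) \<cdot> middle_braid C \<one> X Y \<one> = \<c> X Y \<cdot> (\<l> X \<boxtimes> \<r> Y)"
proof -
  have "(\<l> Y \<boxtimes> \<r> X) \<cdot> middle_braid C \<one> X Y \<one>
      = \<l> (Y \<otimes> X) \<cdot> (id \<one> \<boxtimes> \<r> (Y \<otimes> X)) \<cdot> (id \<one> \<boxtimes> (\<c> X Y \<boxtimes> id \<one>)) \<cdot> rebracket C \<one> X Y \<one>"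
    using assms
    by (simp add: units_outside_rebracket[symmetric] rebracket_middle_braid
        del: interchange interchange_extend)
  also have "\<dots> = \<l> (Y \<otimes> X) \<cdot> (id \<one> \<boxtimes> \<c> X Y) \<cdot> (id \<one> \<boxtimes> \<r> (X \<otimes> Y)) \<cdot> rebracket C \<one> X Y \<one>"
    using assms by (simp add: runit_nat)
  also have "\<dots> = \<c> X Y \<cdot> \<l> (X \<otimes> Y) \<cdot> (id \<one> \<boxtimes> \<r> (X \<otimes> Y)) \<cdot> rebracket C \<one> X Y \<one>"
    using assms by (simp add: comp_extend[OF lunit_nat] del: interchange interchange_extend)
  also have "\<dots> = \<c> X Y \<cdot> (\<l> X \<boxtimes> \<r> Y)"
    using assms by (simp add: units_outside_rebracket)
  finally show ?thesis .
qed

lemma middle_braid_units_right: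
  assumes "X \<in> Obj C" "Y \<in> Obj C"
  shows "(\<r> X \<boxtimes> \<r> Y) \<cdot> middle_braid C X Y \<one> \<one> = \<r> (X \<otimes> Y) \<cdot> (id (X \<otimes> Y) \<boxtimes> \<l> \<one>)"
proof -
  have "(\<r> X \<boxtimes> \<r> Y) = (id X \<boxtimes> \<r> Y) \<cdot> (id X \<boxtimes> \<l> (Y \<otimes> \<one>)) \<cdot> \<a> X \<one> (Y \<otimes> \<one>)"
    using assms by (simp add: triangle del: interchange_extend)
  also have "\<dots> = (id X \<boxtimes> \<r> Y) \<cdot> (id X \<boxtimes> (\<l> Y \<boxtimes> id \<one>)) \<cdot> rebracket C X \<one> Y \<one>"
    using assms by (simp add: rebracket_def lunit_inv_assoc)
  finally have "(\<r> X \<boxtimes> \<r> Y) \<cdot> middle_braid C X Y \<one> \<one>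
      = (id X \<boxtimes> \<r> Y) \<cdot> (id X \<boxtimes> (\<l> Y \<boxtimes> id \<one>)) \<cdot> rebracket C X \<one> Y \<one> \<cdot> middle_braid C X Y \<one> \<one>"
    using assms by simp
  also have "\<dots> = (id X \<boxtimes> \<r> Y) \<cdot> (id X \<boxtimes> ((\<l> Y \<cdot> \<c> Y \<one>) \<boxtimes> id \<one>)) \<cdot> rebracket C X Y \<one> \<one>"
    using assms by (simp add: rebracket_middle_braid)
  also have "\<dots> = (id X \<boxtimes> \<r> Y) \<cdot> (id X \<boxtimes> (id Y \<boxtimes> \<l> \<one>)) \<cdot> \<a> X Y (\<one> \<otimes> \<one>)"
    using assms by (simp add: lunit_braid rebracket_def triangle_inv_assoc)
  also have "\<dots> = (id X \<boxtimes> \<r> Y) \<cdot> \<a> X Y \<one> \<cdot> ((id X \<boxtimes> id Y) \<boxtimes> \<l> \<one>)"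
    using assms by (simp add: assoc_nat del: tensor_id_id)
  also have "\<dots> = \<r> (X \<otimes> Y) \<cdot> (id (X \<otimes> Y) \<boxtimes> \<l> \<one>)"
    using assms by (simp add: comp_extend[OF runit_tensor])
  finally show ?thesis .
qed

lemma middle_braid_units_left:
  assumes "X \<in> Obj C" "Y \<in> Obj C"
  shows "(\<l> X \<boxtimes> \<l> Y) \<cdot> middle_braid C \<one> \<one> X Y = \<l> (X \<otimes> Y) \<cdot> (\<l> \<one> \<boxtimes> id (X \<otimes> Y))"
proof -
  have "(\<l> X \<boxtimes> \<l> Y) = \<l> (X \<otimes> Y) \<cdot> \<a> \<one> X Y \<cdot> ((id \<one> \<boxtimes> id X) \<boxtimes> \<l> Y)"
    using assms by (simp add: comp_extend[OF lunit_tensor])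
  also have "\<dots> = \<l> (X \<otimes> Y) \<cdot> (id \<one> \<boxtimes> (id X \<boxtimes> \<l> Y)) \<cdot> \<a> \<one> X (\<one> \<otimes> Y)"
    using assms by (simp add: assoc_nat del: tensor_id_id)
  also have "\<dots> = \<l> (X \<otimes> Y) \<cdot> (id \<one> \<boxtimes> (\<r> X \<boxtimes> id Y)) \<cdot> rebracket C \<one> X \<one> Y"
    using assms by (simp add: rebracket_def triangle_inv_assoc)
  finally have "(\<l> X \<boxtimes> \<l> Y) \<cdot> middle_braid C \<one> \<one> X Y
      = \<l> (X \<otimes> Y) \<cdot> (id \<one> \<boxtimes> (\<r> X \<boxtimes> id Y)) \<cdot> rebracket C \<one> X \<one> Y \<cdot> middle_braid C \<one> \<one> X Y"
    using assms by simp
  also have "\<dots> = \<l> (X \<otimes> Y) \<cdot> (id \<one> \<boxtimes> ((\<r> X \<cdot> \<c> \<one> X) \<boxtimes> id Y)) \<cdot> rebracket C \<one> \<one> X Y"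
    using assms by (simp add: rebracket_middle_braid)
  also have "\<dots> = \<l> (X \<otimes> Y) \<cdot> (id \<one> \<boxtimes> \<l> (X \<otimes> Y)) \<cdot> \<a> \<one> \<one> (X \<otimes> Y)"
    using assms by (simp add: runit_braid rebracket_def lunit_inv_assoc)
  also have "\<dots> = \<l> (X \<otimes> Y) \<cdot> (\<l> \<one> \<boxtimes> id (X \<otimes> Y))"
    using assms by (simp add: triangle lunit_eq_runit)
  finally show ?thesis .
qed

end


section \<open>Applying a counit to one tensor factor\<close>

context braided_monoidal_category
begin

definition drop_right :: "'o \<Rightarrow> 'm \<Rightarrow> 'm" where
  "drop_right X e = \<r> X \<cdot> (id X \<boxtimes> e)"

definition drop_left :: "'m \<Rightarrow> 'o \<Rightarrow> 'm" where
  "drop_left e Y = \<l> Y \<cdot> (e \<boxtimes> id Y)"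

lemma drop_right_arr [simp]:
  assumes "X \<in> Obj C" "e \<in> Arr C" "Cod C e = \<one>"
  shows "drop_right X e \<in> Arr C" "Dom C (drop_right X e) = X \<otimes> Dom C e" "Cod C (drop_right X e) = X"
  using assms by (auto simp: drop_right_def)

lemma drop_left_arr [simp]:
  assumes "Y \<in> Obj C" "e \<in> Arr C" "Cod C e = \<one>"
  shows "drop_left e Y \<in> Arr C" "Dom C (drop_left e Y) = Dom C e \<otimes> Y" "Cod C (drop_left e Y) = Y"
  using assms by (auto simp: drop_left_def)

lemma drop_right_nat:
  assumes "f \<in> Arr C" "g \<in> Arr C" "e \<in> Arr C" "Cod C e = \<one>" "Cod C f = X" "Cod C g = Dom C e"
  shows "drop_right X e \<cdot> (f \<boxtimes> g) = f \<cdot> drop_right (Dom C f) (e \<cdot> g)"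
proof -
  have "drop_right X e \<cdot> (f \<boxtimes> g) = (\<r> X \<cdot> (f \<boxtimes> id \<one>)) \<cdot> (id (Dom C f) \<boxtimes> (e \<cdot> g))"
    using assms by (auto simp: drop_right_def)
  then show ?thesis using assms by (auto simp: runit_nat drop_right_def)
qed

lemma drop_left_nat:
  assumes "f \<in> Arr C" "g \<in> Arr C" "e \<in> Arr C" "Cod C e = \<one>" "Cod C f = Dom C e" "Cod C g = Y"
  shows "drop_left e Y \<cdot> (f \<boxtimes> g) = g \<cdot> drop_left (e \<cdot> f) (Dom C g)"
proof -
  have "drop_left e Y \<cdot> (f \<boxtimes> g) = (\<l> Y \<cdot> (id \<one> \<boxtimes> g)) \<cdot> ((e \<cdot> f) \<boxtimes> id (Dom C g))"
    using assms by (auto simp: drop_left_def)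
  then show ?thesis using assms by (auto simp: lunit_nat drop_left_def)
qed

lemma drop_right_id: "X \<in> Obj C \<Longrightarrow> drop_right X (id \<one>) = \<r> X"
  by (simp add: drop_right_def)

lemma drop_left_id: "Y \<in> Obj C \<Longrightarrow> drop_left (id \<one>) Y = \<l> Y"
  by (simp add: drop_left_def)

lemma drop_left_tensor:
  assumes "e \<in> Arr C" "Cod C e = \<one>" "Y \<in> Obj C" "Z \<in> Obj C" "Dom C e = X"
  shows "drop_left e (Y \<otimes> Z) \<cdot> \<a> X Y Z = drop_left e Y \<boxtimes> id Z"
proof -
  have "drop_left e (Y \<otimes> Z) \<cdot> \<a> X Y Z = \<l> (Y \<otimes> Z) \<cdot> (e \<boxtimes> (id Y \<boxtimes> id Z)) \<cdot> \<a> X Y Z"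
    using assms by (auto simp: drop_left_def)
  also have "\<dots> = (\<l> (Y \<otimes> Z) \<cdot> \<a> \<one> Y Z) \<cdot> ((e \<boxtimes> id Y) \<boxtimes> id Z)"
    using assms by (auto simp: assoc_nat simp del: tensor_id_id)
  also have "\<dots> = drop_left e Y \<boxtimes> id Z"
    using assms by (auto simp: lunit_tensor drop_left_def simp del: comp_assoc_arr)
  finally show ?thesis .
qed

lemma drop_right_tensor:
  assumes "e \<in> Arr C" "Cod C e = \<one>" "X \<in> Obj C" "Y \<in> Obj C" "Dom C e = Z"
  shows "drop_right (X \<otimes> Y) e \<cdot> inv (\<a> X Y Z) = id X \<boxtimes> drop_right Y e"
proof -
  have "drop_right (X \<otimes> Y) e \<cdot> inv (\<a> X Y Z) = \<r> (X \<otimes> Y) \<cdot> ((id X \<boxtimes> id Y) \<boxtimes> e) \<cdot> inv (\<a> X Y Z)"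
    using assms by (auto simp: drop_right_def)
  also have "\<dots> = (\<r> (X \<otimes> Y) \<cdot> inv (\<a> X Y \<one>)) \<cdot> (id X \<boxtimes> (id Y \<boxtimes> e))"
    using assms by (auto simp: inv_assoc_nat simp del: tensor_id_id)
  also have "\<dots> = id X \<boxtimes> drop_right Y e"
    using assms by (auto simp: runit_inv_assoc drop_right_def simp del: comp_assoc_arr)
  finally show ?thesis .
qed

text \<open>
  Two counits applied to adjacent factors act one after the other; \<open>\<l> \<one>\<close> multiplies their values. For
  a counit this turns multiplicativity into compatibility with the actions.
\<close>

lemma drop_right_twice:
  assumes "e \<in> Arr C" "Cod C e = \<one>" "e' \<in> Arr C" "Cod C e' = \<one>" "X \<in> Obj C"
    "Dom C e = Y" "Dom C e' = Z"
  shows "drop_right X (\<l> \<one> \<cdot> (e \<boxtimes> e')) \<cdot> \<a> X Y Z = drop_right X e' \<cdot> (drop_right X e \<boxtimes> id Z)"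
proof -
  have "drop_right X (\<l> \<one> \<cdot> (e \<boxtimes> e')) \<cdot> \<a> X Y Z
      = \<r> X \<cdot> (id X \<boxtimes> \<l> \<one>) \<cdot> (id X \<boxtimes> (e \<boxtimes> e')) \<cdot> \<a> X Y Z"
    using assms by (auto simp: drop_right_def)
  also have "\<dots> = \<r> X \<cdot> ((id X \<boxtimes> \<l> \<one>) \<cdot> \<a> X \<one> \<one>) \<cdot> ((id X \<boxtimes> e) \<boxtimes> e')"
    using assms by (auto simp: assoc_nat simp del: interchange interchange_extend)
  also have "\<dots> = drop_right X e' \<cdot> (drop_right X e \<boxtimes> id Z)"
    using assms by (auto simp: triangle drop_right_def simp del: comp_assoc_arr)
      (auto)
  finally show ?thesis .
qed

lemma drop_left_twice:
  assumes "e \<in> Arr C" "Cod C e = \<one>" "e' \<in> Arr C" "Cod C e' = \<one>" "Z \<in> Obj C"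
    "Dom C e = X" "Dom C e' = Y"
  shows "drop_left (\<l> \<one> \<cdot> (e \<boxtimes> e')) Z \<cdot> inv (\<a> X Y Z) = drop_left e Z \<cdot> (id X \<boxtimes> drop_left e' Z)"
proof -
  have "drop_left (\<l> \<one> \<cdot> (e \<boxtimes> e')) Z \<cdot> inv (\<a> X Y Z)
      = \<l> Z \<cdot> (\<r> \<one> \<boxtimes> id Z) \<cdot> ((e \<boxtimes> e') \<boxtimes> id Z) \<cdot> inv (\<a> X Y Z)"
    using assms by (auto simp: drop_left_def lunit_eq_runit)
  also have "\<dots> = \<l> Z \<cdot> ((\<r> \<one> \<boxtimes> id Z) \<cdot> inv (\<a> \<one> \<one> Z)) \<cdot> (e \<boxtimes> (e' \<boxtimes> id Z))"
    using assms by (auto simp: inv_assoc_nat simp del: interchange interchange_extend)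
  also have "\<dots> = drop_left e Z \<cdot> (id X \<boxtimes> drop_left e' Z)"
    using assms by (auto simp: triangle_inv_assoc drop_left_def simp del: comp_assoc_arr)
      (auto)
  finally show ?thesis .
qed


section \<open>Coalgebra morphisms\<close>

lemma coalgebra_hom_comp:
  assumes "coalgebra_hom C X \<Delta> \<epsilon> X' \<Delta>' \<epsilon>' f" "coalgebra_hom C X' \<Delta>' \<epsilon>' X'' \<Delta>'' \<epsilon>'' g"
    and "\<Delta> \<in> Hom C X (X \<otimes> X)" "\<Delta>' \<in> Hom C X' (X' \<otimes> X')" "\<Delta>'' \<in> Hom C X'' (X'' \<otimes> X'')"
    and "\<epsilon>' \<in> Hom C X' \<one>" "\<epsilon>'' \<in> Hom C X'' \<one>"
  shows "coalgebra_hom C X \<Delta> \<epsilon> X'' \<Delta>'' \<epsilon>'' (g \<cdot> f)"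
proof -
  have f: "f \<in> Arr C" "Dom C f = X" "Cod C f = X'" "\<Delta>' \<cdot> f = (f \<boxtimes> f) \<cdot> \<Delta>" "\<epsilon>' \<cdot> f = \<epsilon>"
    and g: "g \<in> Arr C" "Dom C g = X'" "Cod C g = X''" "\<Delta>'' \<cdot> g = (g \<boxtimes> g) \<cdot> \<Delta>'" "\<epsilon>'' \<cdot> g = \<epsilon>'"
    using assms(1,2) by (auto simp: coalgebra_hom_def)
  have "\<Delta>'' \<cdot> g \<cdot> f = ((g \<boxtimes> g) \<cdot> \<Delta>') \<cdot> f"
    using f g assms by (simp add: comp_extend[OF g(4)])
  also have "\<dots> = ((g \<cdot> f) \<boxtimes> (g \<cdot> f)) \<cdot> \<Delta>"
    using f g assms by simp
  finally show ?thesis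
    using f g assms by (auto simp: coalgebra_hom_def comp_extend[OF g(5)])
qed

lemma coalgebra_hom_inv:
  assumes "coalgebra_hom C X \<Delta> \<epsilon> X' \<Delta>' \<epsilon>' f" "is_iso C f"
    and "\<Delta> \<in> Hom C X (X \<otimes> X)" "\<Delta>' \<in> Hom C X' (X' \<otimes> X')" "\<epsilon> \<in> Hom C X \<one>" "\<epsilon>' \<in> Hom C X' \<one>"
  shows "coalgebra_hom C X' \<Delta>' \<epsilon>' X \<Delta> \<epsilon> (inv f)"
proof -
  have f: "f \<in> Arr C" "Dom C f = X" "Cod C f = X'" "\<Delta>' \<cdot> f = (f \<boxtimes> f) \<cdot> \<Delta>" "\<epsilon>' \<cdot> f = \<epsilon>"
    using assms(1) by (auto simp: coalgebra_hom_def)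
  have "inv (f \<boxtimes> f) \<cdot> \<Delta>' = \<Delta> \<cdot> inv f"
    by (rule iso_square) (use f assms in auto)
  moreover have "\<epsilon> \<cdot> inv f = \<epsilon>'"
    using f(1-3) assms(2-) by (simp add: f(5)[symmetric])
  ultimately show ?thesis
    using f(1-3) assms by (simp add: coalgebra_hom_def)
qed

lemma tensor_coalgebra_hom:
  assumes "coalgebra_hom C (Carrier B) (Comult B) (Counit B) (Carrier B') (Comult B') (Counit B') f"
    and "coalgebra_hom C (Carrier R) (Comult R) (Counit R) (Carrier R') (Comult R') (Counit R') g"
    and "is_coalgebra C (Carrier B) (Comult B) (Counit B)" "is_coalgebra C (Carrier B') (Comult B') (Counit B')"
    and "is_coalgebra C (Carrier R) (Comult R) (Counit R)" "is_coalgebra C (Carrier R') (Comult R') (Counit R')"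
  shows "coalgebra_hom C (Carrier B \<otimes> Carrier R) (tensor_comult C B R) (tensor_counit C B R)
    (Carrier B' \<otimes> Carrier R') (tensor_comult C B' R') (tensor_counit C B' R') (f \<boxtimes> g)"
proof -
  have f: "f \<in> Arr C" "Dom C f = Carrier B" "Cod C f = Carrier B'"
      "Comult B' \<cdot> f = (f \<boxtimes> f) \<cdot> Comult B" "Counit B' \<cdot> f = Counit B"
    and g: "g \<in> Arr C" "Dom C g = Carrier R" "Cod C g = Carrier R'"
      "Comult R' \<cdot> g = (g \<boxtimes> g) \<cdot> Comult R" "Counit R' \<cdot> g = Counit R"
    using assms(1,2) by (auto simp: coalgebra_hom_def)
  note coalg = assms(3-6)[unfolded is_coalgebra_def]
  have "tensor_comult C B' R' \<cdot> (f \<boxtimes> g)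
      = middle_braid C (Carrier B') (Carrier B') (Carrier R') (Carrier R')
        \<cdot> ((f \<boxtimes> f) \<boxtimes> (g \<boxtimes> g)) \<cdot> (Comult B \<boxtimes> Comult R)"
    using f g coalg by (simp add: tensor_comult_def)
  also have "\<dots> = ((f \<boxtimes> g) \<boxtimes> (f \<boxtimes> g)) \<cdot> tensor_comult C B R"
    using f g coalg
    by (simp add: tensor_comult_def comp_extend[OF middle_braid_nat] del: interchange interchange_extend)
  finally show ?thesis
    using f g coalg by (simp add: coalgebra_hom_def tensor_counit_def mult_unit_def)
qed

end

text \<open>
  Two coalgebras, presented by bialgebra records because \<open>tensor_comult\<close> takes its arguments in
  this form.
\<close>

locale coalgebra_pair = braided_monoidal_category C
  for C :: "('o, 'm, 'x) braided_monoidal_category_scheme" (structure) +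
  fixes R B :: "('o, 'm) bialgebra"
  assumes R_coalgebra: "is_coalgebra C (Carrier R) (Comult R) (Counit R)"
    and B_coalgebra: "is_coalgebra C (Carrier B) (Comult B) (Counit B)"
begin

abbreviation r where "r \<equiv> Carrier R"
abbreviation b where "b \<equiv> Carrier B"

abbreviation onto_R where "onto_R \<equiv> drop_right r (Counit B)"
abbreviation onto_B where "onto_B \<equiv> drop_left (Counit R) b"

lemma coalgebra_arr [simp]:
  "r \<in> Obj C" "b \<in> Obj C"
  "Comult R \<in> Arr C" "Dom C (Comult R) = r" "Cod C (Comult R) = r \<otimes> r"
  "Comult B \<in> Arr C" "Dom C (Comult B) = b" "Cod C (Comult B) = b \<otimes> b"
  "Counit R \<in> Arr C" "Dom C (Counit R) = r" "Cod C (Counit R) = \<one>"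
  "Counit B \<in> Arr C" "Dom C (Counit B) = b" "Cod C (Counit B) = \<one>"
  using R_coalgebra B_coalgebra by (simp_all add: is_coalgebra_def)

lemma tensor_coalgebra_arr [simp]:
  "tensor_comult C R B \<in> Arr C" "Dom C (tensor_comult C R B) = r \<otimes> b"
  "Cod C (tensor_comult C R B) = (r \<otimes> b) \<otimes> (r \<otimes> b)"
  "tensor_counit C R B \<in> Arr C" "Dom C (tensor_counit C R B) = r \<otimes> b"
  "Cod C (tensor_counit C R B) = \<one>"
  by (simp_all add: tensor_comult_def tensor_counit_def mult_unit_def)

lemma counit_comult:
  "drop_left (Counit R) r \<cdot> Comult R = id r" "drop_right r (Counit R) \<cdot> Comult R = id r"
  "drop_left (Counit B) b \<cdot> Comult B = id b" "drop_right b (Counit B) \<cdot> Comult B = id b"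
  using R_coalgebra B_coalgebra by (simp_all add: is_coalgebra_def drop_left_def drop_right_def)

lemma counit_counit_comult:
  "\<l> \<one> \<cdot> (Counit R \<boxtimes> Counit R) \<cdot> Comult R = Counit R"
  "\<l> \<one> \<cdot> (Counit B \<boxtimes> Counit B) \<cdot> Comult B = Counit B"
proof -
  have "\<l> \<one> \<cdot> (Counit R \<boxtimes> Counit R) = Counit R \<cdot> drop_left (Counit R) r"
    using drop_left_nat[of "Counit R" "Counit R" "id \<one>" \<one>] by (simp add: drop_left_id)
  from comp_extend[OF this, of "Comult R"]
  show "\<l> \<one> \<cdot> (Counit R \<boxtimes> Counit R) \<cdot> Comult R = Counit R"
    by (simp add: counit_comult)
  have "\<l> \<one> \<cdot> (Counit B \<boxtimes> Counit B) = Counit B \<cdot> drop_left (Counit B) b"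
    using drop_left_nat[of "Counit B" "Counit B" "id \<one>" \<one>] by (simp add: drop_left_id)
  from comp_extend[OF this, of "Comult B"]
  show "\<l> \<one> \<cdot> (Counit B \<boxtimes> Counit B) \<cdot> Comult B = Counit B"
    by (simp add: counit_comult)
qed

text \<open>
  In each of the next four lemmas the counits slide through the middle braiding by
  naturality, which leaves a middle braiding with two unit arguments.
\<close>

lemma onto_R_coalgebra_hom:
  "coalgebra_hom C (r \<otimes> b) (tensor_comult C R B) (tensor_counit C R B) r (Comult R) (Counit R) onto_R"
proof -
  have "(onto_R \<boxtimes> onto_R) \<cdot> tensor_comult C R B
      = (\<r> r \<boxtimes> \<r> r) \<cdot> ((id r \<boxtimes> Counit B) \<boxtimes> (id r \<boxtimes> Counit B)) \<cdot> middle_braid C r r b b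
        \<cdot> (Comult R \<boxtimes> Comult B)"
    by (simp add: tensor_comult_def drop_right_def)
  also have "\<dots> = (\<r> r \<boxtimes> \<r> r) \<cdot> middle_braid C r r \<one> \<one>
        \<cdot> ((id r \<boxtimes> id r) \<boxtimes> (Counit B \<boxtimes> Counit B)) \<cdot> (Comult R \<boxtimes> Comult B)"
    by (simp add: comp_extend[OF middle_braid_nat] del: interchange interchange_extend tensor_id_id)
  also have "\<dots> = \<r> (r \<otimes> r) \<cdot> (Comult R \<boxtimes> (\<l> \<one> \<cdot> (Counit B \<boxtimes> Counit B) \<cdot> Comult B))"
    by (simp add: comp_extend[OF middle_braid_units_right])
  also have "\<dots> = \<r> (r \<otimes> r) \<cdot> (Comult R \<boxtimes> id \<one>) \<cdot> (id r \<boxtimes> Counit B)"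
    by (simp add: counit_counit_comult)
  also have "\<dots> = Comult R \<cdot> onto_R"
    by (simp add: comp_extend[OF runit_nat] drop_right_def del: interchange interchange_extend)
  finally have comult: "Comult R \<cdot> onto_R = (onto_R \<boxtimes> onto_R) \<cdot> tensor_comult C R B" by simp
  have "Counit R \<cdot> onto_R = \<r> \<one> \<cdot> (Counit R \<boxtimes> id \<one>) \<cdot> (id r \<boxtimes> Counit B)"
    by (simp add: comp_extend[OF runit_nat] drop_right_def del: interchange interchange_extend)
  then show ?thesis
    using comult by (simp add: coalgebra_hom_def tensor_counit_def mult_unit_def lunit_eq_runit)
qed

lemma onto_B_coalgebra_hom:
  "coalgebra_hom C (r \<otimes> b) (tensor_comult C R B) (tensor_counit C R B) b (Comult B) (Counit B) onto_B"
proof -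
  have "(onto_B \<boxtimes> onto_B) \<cdot> tensor_comult C R B
      = (\<l> b \<boxtimes> \<l> b) \<cdot> ((Counit R \<boxtimes> id b) \<boxtimes> (Counit R \<boxtimes> id b)) \<cdot> middle_braid C r r b b
        \<cdot> (Comult R \<boxtimes> Comult B)"
    by (simp add: tensor_comult_def drop_left_def)
  also have "\<dots> = (\<l> b \<boxtimes> \<l> b) \<cdot> middle_braid C \<one> \<one> b b
        \<cdot> ((Counit R \<boxtimes> Counit R) \<boxtimes> (id b \<boxtimes> id b)) \<cdot> (Comult R \<boxtimes> Comult B)"
    by (simp add: comp_extend[OF middle_braid_nat] del: interchange interchange_extend tensor_id_id)
  also have "\<dots> = \<l> (b \<otimes> b) \<cdot> ((\<l> \<one> \<cdot> (Counit R \<boxtimes> Counit R) \<cdot> Comult R) \<boxtimes> Comult B)"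
    by (simp add: comp_extend[OF middle_braid_units_left])
  also have "\<dots> = \<l> (b \<otimes> b) \<cdot> (id \<one> \<boxtimes> Comult B) \<cdot> (Counit R \<boxtimes> id b)"
    by (simp add: counit_counit_comult)
  also have "\<dots> = Comult B \<cdot> onto_B"
    by (simp add: comp_extend[OF lunit_nat] drop_left_def del: interchange interchange_extend)
  finally have comult: "Comult B \<cdot> onto_B = (onto_B \<boxtimes> onto_B) \<cdot> tensor_comult C R B" by simp
  have "Counit B \<cdot> onto_B = \<l> \<one> \<cdot> (id \<one> \<boxtimes> Counit B) \<cdot> (Counit R \<boxtimes> id b)"
    by (simp add: comp_extend[OF lunit_nat] drop_left_def del: interchange interchange_extend)
  then show ?thesis
    using comult by (simp add: coalgebra_hom_def tensor_counit_def mult_unit_def)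
qed

lemma onto_R_onto_B: "(onto_R \<boxtimes> onto_B) \<cdot> tensor_comult C R B = id (r \<otimes> b)"
proof -
  have "(onto_R \<boxtimes> onto_B) \<cdot> tensor_comult C R B
      = (\<r> r \<boxtimes> \<l> b) \<cdot> ((id r \<boxtimes> Counit B) \<boxtimes> (Counit R \<boxtimes> id b)) \<cdot> middle_braid C r r b b
        \<cdot> (Comult R \<boxtimes> Comult B)"
    by (simp add: tensor_comult_def drop_left_def drop_right_def)
  also have "\<dots> = (\<r> r \<boxtimes> \<l> b) \<cdot> middle_braid C r \<one> \<one> b
        \<cdot> ((id r \<boxtimes> Counit R) \<boxtimes> (Counit B \<boxtimes> id b)) \<cdot> (Comult R \<boxtimes> Comult B)"
    by (simp add: comp_extend[OF middle_braid_nat] del: interchange interchange_extend)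
  also have "\<dots> = (drop_right r (Counit R) \<cdot> Comult R) \<boxtimes> (drop_left (Counit B) b \<cdot> Comult B)"
    by (simp add: middle_braid_units_inside drop_left_def drop_right_def)
  finally show ?thesis by (simp add: counit_comult)
qed

text \<open>
  In the opposite order the counits kill the outer factors, and the braiding of the two inner ones is
  what remains.
\<close>

lemma onto_B_onto_R: "(onto_B \<boxtimes> onto_R) \<cdot> tensor_comult C R B = \<c> r b"
proof -
  have "(onto_B \<boxtimes> onto_R) \<cdot> tensor_comult C R B
      = (\<l> b \<boxtimes> \<r> r) \<cdot> ((Counit R \<boxtimes> id b) \<boxtimes> (id r \<boxtimes> Counit B)) \<cdot> middle_braid C r r b b
        \<cdot> (Comult R \<boxtimes> Comult B)"
    by (simp add: tensor_comult_def drop_left_def drop_right_def)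
  also have "\<dots> = (\<l> b \<boxtimes> \<r> r) \<cdot> middle_braid C \<one> r b \<one>
        \<cdot> ((Counit R \<boxtimes> id r) \<boxtimes> (id b \<boxtimes> Counit B)) \<cdot> (Comult R \<boxtimes> Comult B)"
    by (simp add: comp_extend[OF middle_braid_nat] del: interchange interchange_extend)
  also have "\<dots> = \<c> r b \<cdot> ((drop_left (Counit R) r \<cdot> Comult R) \<boxtimes> (drop_right b (Counit B) \<cdot> Comult B))"
    by (simp add: comp_extend[OF middle_braid_units_outside] drop_left_def drop_right_def)
  finally show ?thesis by (simp add: counit_comult)
qed

end


section \<open>Products of arrows into an algebra\<close>

locale algebra_object = braided_monoidal_category C
  for C :: "('o, 'm, 'x) braided_monoidal_category_scheme" (structure) +
  fixes X :: 'o and m u :: 'm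
  assumes algebra: "is_algebra C X m u"
begin

text \<open>
  The product of two generalised elements of \<open>X\<close> with independent parameters. It lets one calculate
  with arrows into \<open>X\<close> as with elements of a ring, an associator of the parameters appearing only
  when brackets are moved.
\<close>

definition arrow_product :: "'m \<Rightarrow> 'm \<Rightarrow> 'm"  (infix "\<star>" 65) where
  "f \<star> g = m \<cdot> (f \<boxtimes> g)"

lemma algebra_arr [simp]:
  "X \<in> Obj C" "m \<in> Arr C" "Dom C m = X \<otimes> X" "Cod C m = X"
  "u \<in> Arr C" "Dom C u = \<one>" "Cod C u = X"
  using algebra by (simp_all add: is_algebra_def)

lemma arrow_product_arr [simp]:
  assumes "f \<in> Arr C" "g \<in> Arr C" "Cod C f = X" "Cod C g = X"
  shows "f \<star> g \<in> Arr C" "Dom C (f \<star> g) = Dom C f \<otimes> Dom C g" "Cod C (f \<star> g) = X"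
  using assms by (auto simp: arrow_product_def)

lemma arrow_product_comp:
  assumes "f \<in> Arr C" "g \<in> Arr C" "Cod C f = X" "Cod C g = X"
    "p \<in> Arr C" "q \<in> Arr C" "Cod C p = Dom C f" "Cod C q = Dom C g"
  shows "(f \<star> g) \<cdot> (p \<boxtimes> q) = (f \<cdot> p) \<star> (g \<cdot> q)"
  using assms by (simp add: arrow_product_def)

lemma arrow_product_assoc:
  assumes "f \<in> Arr C" "g \<in> Arr C" "h \<in> Arr C" "Cod C f = X" "Cod C g = X" "Cod C h = X"
  shows "(f \<star> g) \<star> h = (f \<star> (g \<star> h)) \<cdot> \<a> (Dom C f) (Dom C g) (Dom C h)"
proof -
  have "(f \<star> g) \<star> h = (m \<cdot> (m \<boxtimes> id X)) \<cdot> ((f \<boxtimes> g) \<boxtimes> h)"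
    using assms by (auto simp: arrow_product_def)
  also have "m \<cdot> (m \<boxtimes> id X) = m \<cdot> (id X \<boxtimes> m) \<cdot> \<a> X X X"
    using algebra by (simp add: is_algebra_def)
  also have "(m \<cdot> (id X \<boxtimes> m) \<cdot> \<a> X X X) \<cdot> ((f \<boxtimes> g) \<boxtimes> h)
      = (f \<star> (g \<star> h)) \<cdot> \<a> (Dom C f) (Dom C g) (Dom C h)"
    using assms by (auto simp: arrow_product_def assoc_nat)
  finally show ?thesis .
qed

lemma arrow_product_assoc_inv:
  assumes "f \<in> Arr C" "g \<in> Arr C" "h \<in> Arr C" "Cod C f = X" "Cod C g = X" "Cod C h = X"
  shows "f \<star> (g \<star> h) = ((f \<star> g) \<star> h) \<cdot> inv (\<a> (Dom C f) (Dom C g) (Dom C h))"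
  using assms by (auto simp: arrow_product_assoc)

lemma arrow_product_rebracket:
  assumes "f \<in> Arr C" "g \<in> Arr C" "h \<in> Arr C" "k \<in> Arr C"
    "Cod C f = X" "Cod C g = X" "Cod C h = X" "Cod C k = X"
  shows "(f \<star> g) \<star> (h \<star> k)
    = (f \<star> ((g \<star> h) \<star> k)) \<cdot> rebracket C (Dom C f) (Dom C g) (Dom C h) (Dom C k)"
proof -
  have "(f \<star> g) \<star> (h \<star> k) = (f \<star> (g \<star> (h \<star> k))) \<cdot> \<a> (Dom C f) (Dom C g) (Dom C h \<otimes> Dom C k)"
    using assms by (simp add: arrow_product_assoc)
  also have "f \<star> (g \<star> (h \<star> k))
      = (f \<star> ((g \<star> h) \<star> k)) \<cdot> (id (Dom C f) \<boxtimes> inv (\<a> (Dom C g) (Dom C h) (Dom C k)))"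
    using assms by (simp add: arrow_product_comp arrow_product_assoc_inv[of g h k] iso_inv)
  finally show ?thesis
    using assms by (simp add: rebracket_def)
qed

lemma unit_arrow_product:
  assumes "f \<in> Arr C" "Cod C f = X"
  shows "u \<star> f = f \<cdot> \<l> (Dom C f)" "f \<star> u = f \<cdot> \<r> (Dom C f)"
proof -
  have "u \<star> f = (m \<cdot> (u \<boxtimes> id X)) \<cdot> (id \<one> \<boxtimes> f)" "f \<star> u = (m \<cdot> (id X \<boxtimes> u)) \<cdot> (f \<boxtimes> id \<one>)"
    using assms by (auto simp: arrow_product_def)
  then show "u \<star> f = f \<cdot> \<l> (Dom C f)" "f \<star> u = f \<cdot> \<r> (Dom C f)"
    using assms algebra by (auto simp: is_algebra_def lunit_nat runit_nat simp del: comp_assoc_arr)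
qed

end


section \<open>Transport of a bialgebra along an isomorphism\<close>

context braided_monoidal_category
begin

lemma bialgebra_arr:
  assumes "is_bialgebra C A"
  shows "Carrier A \<in> Obj C"
    "Mult A \<in> Arr C" "Dom C (Mult A) = Carrier A \<otimes> Carrier A" "Cod C (Mult A) = Carrier A"
    "Unit A \<in> Arr C" "Dom C (Unit A) = \<one>" "Cod C (Unit A) = Carrier A"
    "Comult A \<in> Arr C" "Dom C (Comult A) = Carrier A" "Cod C (Comult A) = Carrier A \<otimes> Carrier A"
    "Counit A \<in> Arr C" "Dom C (Counit A) = Carrier A" "Cod C (Counit A) = \<one>"
  using assms by (simp_all add: is_bialgebra_def is_algebra_def is_coalgebra_def)

lemma mult_coalgebra_hom:
  assumes "is_bialgebra C A"
  shows "coalgebra_hom C (Carrier A \<otimes> Carrier A) (tensor_comult C A A) (tensor_counit C A A)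
    (Carrier A) (Comult A) (Counit A) (Mult A)"
  using assms bialgebra_arr[OF assms]
  by (simp add: is_bialgebra_def coalgebra_hom_def tensor_comult_def tensor_counit_def)

text \<open>
  Each axiom for \<open>X\<close> follows from the same axiom for \<open>A\<close> by cancelling \<open>f\<close> or one of its
  tensor powers.
\<close>

lemma bialgebra_transport:
  assumes A: "is_bialgebra C A" and f_hom: "bialgebra_hom C X A f" and iso: "is_iso C f"
    and X: "Mult X \<in> Hom C (Carrier X \<otimes> Carrier X) (Carrier X)" "Unit X \<in> Hom C \<one> (Carrier X)"
      "Comult X \<in> Hom C (Carrier X) (Carrier X \<otimes> Carrier X)" "Counit X \<in> Hom C (Carrier X) \<one>"
  shows "is_bialgebra C X"
proof -
  let ?a = "Carrier A" and ?x = "Carrier X"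
  note A_arr [simp] = bialgebra_arr[OF A]
  have f [simp]: "f \<in> Arr C" "Dom C f = ?x" "Cod C f = ?a"
    using f_hom by (simp_all add: bialgebra_hom_def algebra_hom_def)
  have [simp]: "?x \<in> Obj C" using f dom_cod_obj(1)[of f] by simp
  note X_arr [simp] = X[unfolded in_hom_iff]
  have f_mult: "f \<cdot> Mult X = Mult A \<cdot> (f \<boxtimes> f)" and f_unit: "f \<cdot> Unit X = Unit A"
    and f_comult: "(f \<boxtimes> f) \<cdot> Comult X = Comult A \<cdot> f" and f_counit: "Counit X = Counit A \<cdot> f"
    using f_hom by (simp_all add: bialgebra_hom_def algebra_hom_def coalgebra_hom_def)
  note f_mult' = comp_extend[OF f_mult] and f_unit' = comp_extend[OF f_unit]
    and f_comult' = comp_extend[OF f_comult]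
  note A_axioms = A[unfolded is_bialgebra_def is_algebra_def is_coalgebra_def]
  interpret A: algebra_object C ?a "Mult A" "Unit A"
    by standard (use A in \<open>simp add: is_bialgebra_def\<close>)

  have "Mult X \<cdot> (Mult X \<boxtimes> id ?x) = Mult X \<cdot> (id ?x \<boxtimes> Mult X) \<cdot> \<a> ?x ?x ?x"
  proof (rule iso_monic[OF iso])
    have "f \<cdot> Mult X \<cdot> (Mult X \<boxtimes> id ?x) = A.arrow_product (A.arrow_product f f) f"
      by (simp add: f_mult' f_mult A.arrow_product_def)
    also have "\<dots> = A.arrow_product f (A.arrow_product f f) \<cdot> \<a> ?x ?x ?x"
      by (simp add: A.arrow_product_assoc)
    also have "\<dots> = f \<cdot> Mult X \<cdot> (id ?x \<boxtimes> Mult X) \<cdot> \<a> ?x ?x ?x"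
      by (simp add: f_mult' f_mult A.arrow_product_def)
    finally show "f \<cdot> Mult X \<cdot> (Mult X \<boxtimes> id ?x) = f \<cdot> Mult X \<cdot> (id ?x \<boxtimes> Mult X) \<cdot> \<a> ?x ?x ?x" .
  qed auto
  moreover have "Mult X \<cdot> (Unit X \<boxtimes> id ?x) = \<l> ?x"
    by (rule iso_monic[OF iso])
      (use A.unit_arrow_product(1)[of f] in \<open>auto simp: f_mult' f_unit A.arrow_product_def\<close>)
  moreover have "Mult X \<cdot> (id ?x \<boxtimes> Unit X) = \<r> ?x"
    by (rule iso_monic[OF iso])
      (use A.unit_arrow_product(2)[of f] in \<open>auto simp: f_mult' f_unit A.arrow_product_def\<close>)
  ultimately have alg: "is_algebra C ?x (Mult X) (Unit X)"
    by (simp add: is_algebra_def)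

  have "\<a> ?x ?x ?x \<cdot> (Comult X \<boxtimes> id ?x) \<cdot> Comult X = (id ?x \<boxtimes> Comult X) \<cdot> Comult X"
  proof (rule iso_monic[of "f \<boxtimes> (f \<boxtimes> f)"])
    have "(f \<boxtimes> (f \<boxtimes> f)) \<cdot> \<a> ?x ?x ?x \<cdot> (Comult X \<boxtimes> id ?x) \<cdot> Comult X
        = \<a> ?a ?a ?a \<cdot> (((f \<boxtimes> f) \<cdot> Comult X) \<boxtimes> f) \<cdot> Comult X"
      using comp_extend[OF assoc_nat[of f f f ?a ?a ?a, symmetric]] by simp
    also have "\<dots> = \<a> ?a ?a ?a \<cdot> (Comult A \<boxtimes> id ?a) \<cdot> (f \<boxtimes> f) \<cdot> Comult X"
      by (simp add: f_comult[symmetric])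
    also have "\<dots> = (\<a> ?a ?a ?a \<cdot> (Comult A \<boxtimes> id ?a) \<cdot> Comult A) \<cdot> f"
      by (simp only: f_comult) simp
    also have "\<dots> = (id ?a \<boxtimes> Comult A) \<cdot> Comult A \<cdot> f"
      using A_axioms by (simp del: interchange interchange_extend)
    also have "\<dots> = (id ?a \<boxtimes> Comult A) \<cdot> (f \<boxtimes> f) \<cdot> Comult X"
      by (simp only: f_comult)
    also have "\<dots> = (f \<boxtimes> (f \<boxtimes> f)) \<cdot> (id ?x \<boxtimes> Comult X) \<cdot> Comult X"
      by (simp add: f_comult[symmetric])
    finally show "(f \<boxtimes> (f \<boxtimes> f)) \<cdot> \<a> ?x ?x ?x \<cdot> (Comult X \<boxtimes> id ?x) \<cdot> Comult X
        = (f \<boxtimes> (f \<boxtimes> f)) \<cdot> (id ?x \<boxtimes> Comult X) \<cdot> Comult X" .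
  qed (use iso in auto)
  moreover have "\<l> ?x \<cdot> (Counit X \<boxtimes> id ?x) \<cdot> Comult X = id ?x"
  proof (rule iso_monic[OF iso])
    have "f \<cdot> \<l> ?x \<cdot> (Counit X \<boxtimes> id ?x) \<cdot> Comult X
        = \<l> ?a \<cdot> (id \<one> \<boxtimes> f) \<cdot> (Counit X \<boxtimes> id ?x) \<cdot> Comult X"
      by (simp add: comp_extend[OF lunit_nat] del: interchange interchange_extend)
    also have "\<dots> = \<l> ?a \<cdot> (Counit A \<boxtimes> id ?a) \<cdot> (f \<boxtimes> f) \<cdot> Comult X"
      by (simp add: f_counit)
    also have "\<dots> = (\<l> ?a \<cdot> (Counit A \<boxtimes> id ?a) \<cdot> Comult A) \<cdot> f"
      by (simp only: f_comult) simp
    also have "\<dots> = f \<cdot> id ?x"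
      using A_axioms by (simp del: interchange interchange_extend comp_assoc_arr)
    finally show "f \<cdot> \<l> ?x \<cdot> (Counit X \<boxtimes> id ?x) \<cdot> Comult X = f \<cdot> id ?x" .
  qed auto
  moreover have "\<r> ?x \<cdot> (id ?x \<boxtimes> Counit X) \<cdot> Comult X = id ?x"
  proof (rule iso_monic[OF iso])
    have "f \<cdot> \<r> ?x \<cdot> (id ?x \<boxtimes> Counit X) \<cdot> Comult X
        = \<r> ?a \<cdot> (f \<boxtimes> id \<one>) \<cdot> (id ?x \<boxtimes> Counit X) \<cdot> Comult X"
      by (simp add: comp_extend[OF runit_nat] del: interchange interchange_extend)
    also have "\<dots> = \<r> ?a \<cdot> (id ?a \<boxtimes> Counit A) \<cdot> (f \<boxtimes> f) \<cdot> Comult X"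
      by (simp add: f_counit)
    also have "\<dots> = (\<r> ?a \<cdot> (id ?a \<boxtimes> Counit A) \<cdot> Comult A) \<cdot> f"
      by (simp only: f_comult) simp
    also have "\<dots> = f \<cdot> id ?x"
      using A_axioms by (simp del: interchange interchange_extend comp_assoc_arr)
    finally show "f \<cdot> \<r> ?x \<cdot> (id ?x \<boxtimes> Counit X) \<cdot> Comult X = f \<cdot> id ?x" .
  qed auto
  ultimately have coalg: "is_coalgebra C ?x (Comult X) (Counit X)"
    by (simp add: is_coalgebra_def)

  have comult_mult: "Comult X \<cdot> Mult X
      = (Mult X \<boxtimes> Mult X) \<cdot> middle_braid C ?x ?x ?x ?x \<cdot> (Comult X \<boxtimes> Comult X)"
  proof (rule iso_monic[of "f \<boxtimes> f"])
    have "(f \<boxtimes> f) \<cdot> Comult X \<cdot> Mult X = (Comult A \<cdot> Mult A) \<cdot> (f \<boxtimes> f)"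
      by (simp add: f_comult' f_mult)
    also have "Comult A \<cdot> Mult A
        = (Mult A \<boxtimes> Mult A) \<cdot> middle_braid C ?a ?a ?a ?a \<cdot> (Comult A \<boxtimes> Comult A)"
      using A_axioms by blast
    also have "((Mult A \<boxtimes> Mult A) \<cdot> middle_braid C ?a ?a ?a ?a \<cdot> (Comult A \<boxtimes> Comult A)) \<cdot> (f \<boxtimes> f)
        = (Mult A \<boxtimes> Mult A) \<cdot> middle_braid C ?a ?a ?a ?a \<cdot> ((f \<boxtimes> f) \<boxtimes> (f \<boxtimes> f)) \<cdot> (Comult X \<boxtimes> Comult X)"
      by (simp add: f_comult)
    also have "\<dots> = (Mult A \<boxtimes> Mult A) \<cdot> ((f \<boxtimes> f) \<boxtimes> (f \<boxtimes> f)) \<cdot> middle_braid C ?x ?x ?x ?x \<cdot> (Comult X \<boxtimes> Comult X)"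
      by (simp add: comp_extend[OF middle_braid_nat] del: interchange interchange_extend)
    also have "\<dots> = (f \<boxtimes> f) \<cdot> (Mult X \<boxtimes> Mult X) \<cdot> middle_braid C ?x ?x ?x ?x \<cdot> (Comult X \<boxtimes> Comult X)"
      by (simp add: f_mult)
    finally show "(f \<boxtimes> f) \<cdot> Comult X \<cdot> Mult X
        = (f \<boxtimes> f) \<cdot> (Mult X \<boxtimes> Mult X) \<cdot> middle_braid C ?x ?x ?x ?x \<cdot> (Comult X \<boxtimes> Comult X)" .
  qed (use iso in auto)
  have "Counit A \<cdot> Mult A = mult_unit C \<cdot> (Counit A \<boxtimes> Counit A)"
    using A_axioms by blast
  from comp_extend[OF this]
  have counit_mult: "Counit X \<cdot> Mult X = mult_unit C \<cdot> (Counit X \<boxtimes> Counit X)"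
    by (simp add: f_counit f_mult mult_unit_def)
  have comult_unit: "Comult X \<cdot> Unit X = (Unit X \<boxtimes> Unit X) \<cdot> comult_unit C"
  proof (rule iso_monic[of "f \<boxtimes> f"])
    have "(f \<boxtimes> f) \<cdot> Comult X \<cdot> Unit X = Comult A \<cdot> Unit A"
      by (simp add: f_comult' f_unit)
    also have "\<dots> = (Unit A \<boxtimes> Unit A) \<cdot> comult_unit C"
      using A_axioms by blast
    also have "\<dots> = (f \<boxtimes> f) \<cdot> (Unit X \<boxtimes> Unit X) \<cdot> comult_unit C"
      by (simp add: f_unit comult_unit_def mult_unit_def)
    finally show "(f \<boxtimes> f) \<cdot> Comult X \<cdot> Unit X = (f \<boxtimes> f) \<cdot> (Unit X \<boxtimes> Unit X) \<cdot> comult_unit C" .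
  qed (use iso in \<open>auto simp: comult_unit_def mult_unit_def\<close>)
  have "Counit X \<cdot> Unit X = id \<one>"
    using A_axioms by (simp add: f_counit f_unit)
  with alg coalg comult_mult counit_mult comult_unit show ?thesis
    by (simp add: is_bialgebra_def)
qed

lemma bialgebra_hom_inv:
  assumes "is_bialgebra C X" "is_bialgebra C A" "bialgebra_hom C X A f" "is_iso C f"
  shows "bialgebra_hom C A X (inv f)"
proof -
  note [simp] = bialgebra_arr[OF assms(1)] bialgebra_arr[OF assms(2)]
  have f: "f \<in> Arr C" "Dom C f = Carrier X" "Cod C f = Carrier A"
    and mult: "f \<cdot> Mult X = Mult A \<cdot> (f \<boxtimes> f)" and unit: "Unit A = f \<cdot> Unit X"
    using assms(3) by (simp_all add: bialgebra_hom_def algebra_hom_def)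
  have "inv f \<cdot> Mult A = Mult X \<cdot> inv (f \<boxtimes> f)"
    by (rule iso_square) (use f mult assms(4) in auto)
  then have "algebra_hom C (Carrier A) (Mult A) (Unit A) (Carrier X) (Mult X) (Unit X) (inv f)"
    using f assms(4) by (simp add: algebra_hom_def unit)
  moreover have "coalgebra_hom C (Carrier A) (Comult A) (Counit A) (Carrier X) (Comult X) (Counit X) (inv f)"
    by (rule coalgebra_hom_inv) (use assms(3,4) in \<open>auto simp: bialgebra_hom_def\<close>)
  ultimately show ?thesis by (simp add: bialgebra_hom_def)
qed

end


section \<open>Factorisation of a bialgebra\<close>

locale bialgebra_factorisation = braided_monoidal_category C
  for C :: "('o, 'm, 'x) braided_monoidal_category_scheme" (structure) +
  fixes A B R :: "('o, 'm) bialgebra" and \<sigma> i :: 'm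
  assumes A_bialgebra: "is_bialgebra C A"
    and B_bialgebra: "is_bialgebra C B"
    and R_bialgebra: "is_bialgebra C R"
    and \<sigma>_hom: "bialgebra_hom C B A \<sigma>"
    and i_hom: "bialgebra_hom C R A i"
    and factorises: "is_iso C (Mult A \<cdot> (i \<boxtimes> \<sigma>))"

sublocale bialgebra_factorisation \<subseteq> coalgebra_pair C R B
  by standard (use R_bialgebra B_bialgebra in \<open>auto simp: is_bialgebra_def\<close>)

text \<open>
  The exchange map goes between the two orders of the tensor product, so the coalgebra structures on
  both \<open>R \<otimes> B\<close> and \<open>B \<otimes> R\<close> are needed.
\<close>

sublocale bialgebra_factorisation \<subseteq> BR: coalgebra_pair C B R
  by standard (use R_bialgebra B_bialgebra in \<open>auto simp: is_bialgebra_def\<close>)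

sublocale bialgebra_factorisation \<subseteq> algebra_object C "Carrier A" "Mult A" "Unit A"
  by standard (use A_bialgebra in \<open>auto simp: is_bialgebra_def\<close>)

context bialgebra_factorisation
begin

abbreviation product_in_A  (infix "\<star>" 65) where "f \<star> g \<equiv> arrow_product f g"

lemmas bialgebra_arrs [simp] =
  bialgebra_arr[OF A_bialgebra] bialgebra_arr[OF B_bialgebra] bialgebra_arr[OF R_bialgebra]

lemma hom_arrs [simp]:
  "\<sigma> \<in> Arr C" "Dom C \<sigma> = b" "Cod C \<sigma> = Carrier A"
  "i \<in> Arr C" "Dom C i = r" "Cod C i = Carrier A"
  using \<sigma>_hom i_hom by (simp_all add: bialgebra_hom_def algebra_hom_def)

lemma hom_mult: "\<sigma> \<star> \<sigma> = \<sigma> \<cdot> Mult B" "i \<star> i = i \<cdot> Mult R"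
  using \<sigma>_hom i_hom by (simp_all add: bialgebra_hom_def algebra_hom_def arrow_product_def)

lemma hom_unit: "\<sigma> \<cdot> Unit B = Unit A" "i \<cdot> Unit R = Unit A"
  using \<sigma>_hom i_hom by (simp_all add: bialgebra_hom_def algebra_hom_def)

definition \<Phi> where "\<Phi> = i \<star> \<sigma>"
definition \<Theta> where "\<Theta> = \<sigma> \<star> i"
definition \<Psi> where "\<Psi> = inv \<Phi> \<cdot> \<Theta>"

lemma \<Phi>_iso [simp]: "is_iso C \<Phi>"
  using factorises by (simp add: \<Phi>_def arrow_product_def)

lemma factorisation_arrs [simp]:
  "\<Phi> \<in> Arr C" "Dom C \<Phi> = r \<otimes> b" "Cod C \<Phi> = Carrier A"
  "\<Theta> \<in> Arr C" "Dom C \<Theta> = b \<otimes> r" "Cod C \<Theta> = Carrier A"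
  by (simp_all add: \<Phi>_def \<Theta>_def)

lemma \<Psi>_arr [simp]: "\<Psi> \<in> Arr C" "Dom C \<Psi> = b \<otimes> r" "Cod C \<Psi> = r \<otimes> b"
  by (simp_all add: \<Psi>_def)

lemma \<Phi>_\<Psi>: "\<Phi> \<cdot> \<Psi> = \<Theta>"
  by (simp add: \<Psi>_def)

lemmas \<Phi>_\<Psi>_extend = comp_extend[OF \<Phi>_\<Psi>]


section \<open>The exchange map is a distributive law\<close>

text \<open>
  Along \<open>\<Phi>\<close> both sides become the product of \<open>\<sigma>\<close>, \<open>\<sigma>\<close>, \<open>i\<close>. Starting from \<open>(\<sigma> \<star> \<sigma>) \<star> i\<close>,
  each occurrence of \<open>\<sigma> \<star> i = \<Phi> \<cdot> \<Psi>\<close> is traded for \<open>i \<star> \<sigma> = \<Phi>\<close> at the cost of one \<open>\<Psi>\<close>,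
  until \<open>i\<close> has moved to the front.
\<close>

lemma \<Psi>_mult_B:
  "\<Psi> \<cdot> (Mult B \<boxtimes> id r)
    = (id r \<boxtimes> Mult B) \<cdot> \<a> r b b \<cdot> (\<Psi> \<boxtimes> id b) \<cdot> inv (\<a> b r b) \<cdot> (id b \<boxtimes> \<Psi>) \<cdot> \<a> b b r"
proof (rule iso_monic[OF \<Phi>_iso])
  have "\<Phi> \<cdot> \<Psi> \<cdot> (Mult B \<boxtimes> id r) = (\<sigma> \<star> \<sigma>) \<star> i"
    by (simp add: \<Phi>_\<Psi>_extend \<Theta>_def arrow_product_comp hom_mult)
  also have "\<dots> = (\<sigma> \<star> (\<Phi> \<cdot> \<Psi>)) \<cdot> \<a> b b r"
    by (simp add: arrow_product_assoc \<Phi>_\<Psi> \<Theta>_def)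
  also have "\<sigma> \<star> (\<Phi> \<cdot> \<Psi>) = (\<sigma> \<star> (i \<star> \<sigma>)) \<cdot> (id b \<boxtimes> \<Psi>)"
    by (simp add: arrow_product_comp \<Phi>_def)
  also have "\<sigma> \<star> (i \<star> \<sigma>) = ((\<Phi> \<cdot> \<Psi>) \<star> \<sigma>) \<cdot> inv (\<a> b r b)"
    by (simp add: arrow_product_assoc_inv \<Phi>_\<Psi> \<Theta>_def)
  also have "(\<Phi> \<cdot> \<Psi>) \<star> \<sigma> = ((i \<star> \<sigma>) \<star> \<sigma>) \<cdot> (\<Psi> \<boxtimes> id b)"
    by (simp add: arrow_product_comp \<Phi>_def)
  also have "(i \<star> \<sigma>) \<star> \<sigma> = \<Phi> \<cdot> (id r \<boxtimes> Mult B) \<cdot> \<a> r b b"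
    by (simp add: arrow_product_assoc hom_mult \<Phi>_def)
      (simp add: comp_extend[OF arrow_product_comp])
  finally show "\<Phi> \<cdot> \<Psi> \<cdot> (Mult B \<boxtimes> id r)
      = \<Phi> \<cdot> (id r \<boxtimes> Mult B) \<cdot> \<a> r b b \<cdot> (\<Psi> \<boxtimes> id b) \<cdot> inv (\<a> b r b) \<cdot> (id b \<boxtimes> \<Psi>) \<cdot> \<a> b b r"
    by simp
qed auto

lemma \<Psi>_mult_R:
  "\<Psi> \<cdot> (id b \<boxtimes> Mult R)
    = (Mult R \<boxtimes> id b) \<cdot> inv (\<a> r r b) \<cdot> (id r \<boxtimes> \<Psi>) \<cdot> \<a> r b r \<cdot> (\<Psi> \<boxtimes> id r) \<cdot> inv (\<a> b r r)"
proof (rule iso_monic[OF \<Phi>_iso])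
  have "\<Phi> \<cdot> \<Psi> \<cdot> (id b \<boxtimes> Mult R) = \<sigma> \<star> (i \<star> i)"
    by (simp add: \<Phi>_\<Psi>_extend \<Theta>_def arrow_product_comp hom_mult)
  also have "\<dots> = ((\<Phi> \<cdot> \<Psi>) \<star> i) \<cdot> inv (\<a> b r r)"
    by (simp add: arrow_product_assoc_inv \<Phi>_\<Psi> \<Theta>_def)
  also have "(\<Phi> \<cdot> \<Psi>) \<star> i = ((i \<star> \<sigma>) \<star> i) \<cdot> (\<Psi> \<boxtimes> id r)"
    by (simp add: arrow_product_comp \<Phi>_def)
  also have "(i \<star> \<sigma>) \<star> i = (i \<star> (\<Phi> \<cdot> \<Psi>)) \<cdot> \<a> r b r"
    by (simp add: arrow_product_assoc \<Phi>_\<Psi> \<Theta>_def)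
  also have "i \<star> (\<Phi> \<cdot> \<Psi>) = (i \<star> (i \<star> \<sigma>)) \<cdot> (id r \<boxtimes> \<Psi>)"
    by (simp add: arrow_product_comp \<Phi>_def)
  also have "i \<star> (i \<star> \<sigma>) = \<Phi> \<cdot> (Mult R \<boxtimes> id b) \<cdot> inv (\<a> r r b)"
    by (simp add: arrow_product_assoc_inv hom_mult \<Phi>_def)
      (simp add: comp_extend[OF arrow_product_comp])
  finally show "\<Phi> \<cdot> \<Psi> \<cdot> (id b \<boxtimes> Mult R)
      = \<Phi> \<cdot> (Mult R \<boxtimes> id b) \<cdot> inv (\<a> r r b) \<cdot> (id r \<boxtimes> \<Psi>) \<cdot> \<a> r b r \<cdot> (\<Psi> \<boxtimes> id r) \<cdot> inv (\<a> b r r)"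
    by simp
qed auto

text \<open>
  Both sides become \<open>i\<close> along \<open>\<Phi>\<close>, up to unit constraints, since the unit of \<open>A\<close> commutes
  with \<open>i\<close>.
\<close>

lemma \<Psi>_unit_B: "\<Psi> \<cdot> (Unit B \<boxtimes> id r) = (id r \<boxtimes> Unit B) \<cdot> inv (\<r> r) \<cdot> \<l> r"
proof (rule iso_monic[OF \<Phi>_iso])
  have "\<Phi> \<cdot> \<Psi> \<cdot> (Unit B \<boxtimes> id r) = Unit A \<star> i"
    by (simp add: \<Phi>_\<Psi>_extend \<Theta>_def arrow_product_comp hom_unit)
  also have "\<dots> = (i \<star> Unit A) \<cdot> inv (\<r> r) \<cdot> \<l> r"
    by (simp add: unit_arrow_product)
  also have "i \<star> Unit A = \<Phi> \<cdot> (id r \<boxtimes> Unit B)"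
    by (simp add: \<Phi>_def arrow_product_comp hom_unit)
  finally show "\<Phi> \<cdot> \<Psi> \<cdot> (Unit B \<boxtimes> id r) = \<Phi> \<cdot> (id r \<boxtimes> Unit B) \<cdot> inv (\<r> r) \<cdot> \<l> r"
    by simp
qed auto

lemma \<Psi>_unit_R: "\<Psi> \<cdot> (id b \<boxtimes> Unit R) = (Unit R \<boxtimes> id b) \<cdot> inv (\<l> b) \<cdot> \<r> b"
proof (rule iso_monic[OF \<Phi>_iso])
  have "\<Phi> \<cdot> \<Psi> \<cdot> (id b \<boxtimes> Unit R) = \<sigma> \<star> Unit A"
    by (simp add: \<Phi>_\<Psi>_extend \<Theta>_def arrow_product_comp hom_unit)
  also have "\<dots> = (Unit A \<star> \<sigma>) \<cdot> inv (\<l> b) \<cdot> \<r> b"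
    by (simp add: unit_arrow_product)
  also have "Unit A \<star> \<sigma> = \<Phi> \<cdot> (Unit R \<boxtimes> id b)"
    by (simp add: \<Phi>_def arrow_product_comp hom_unit)
  finally show "\<Phi> \<cdot> \<Psi> \<cdot> (id b \<boxtimes> Unit R) = \<Phi> \<cdot> (Unit R \<boxtimes> id b) \<cdot> inv (\<l> b) \<cdot> \<r> b"
    by simp
qed auto


section \<open>The exchange map is a coalgebra morphism\<close>

text \<open>
  This covers \<open>\<Phi>\<close> and \<open>\<Theta>\<close> at once. It is where multiplicativity of the comultiplication of
  \<open>A\<close> enters.
\<close>

lemma mult_A_coalgebra_hom:
  assumes f: "bialgebra_hom C X A f" and g: "bialgebra_hom C Y A g"
    and X: "is_bialgebra C X" and Y: "is_bialgebra C Y"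
  shows "coalgebra_hom C (Carrier X \<otimes> Carrier Y) (tensor_comult C X Y) (tensor_counit C X Y)
    (Carrier A) (Comult A) (Counit A) (f \<star> g)"
  unfolding arrow_product_def
proof (rule coalgebra_hom_comp[OF _ mult_coalgebra_hom[OF A_bialgebra]])
  show "coalgebra_hom C (Carrier X \<otimes> Carrier Y) (tensor_comult C X Y) (tensor_counit C X Y)
     (Carrier A \<otimes> Carrier A) (tensor_comult C A A) (tensor_counit C A A) (f \<boxtimes> g)"
    by (rule tensor_coalgebra_hom)
      (use assms A_bialgebra in \<open>auto simp: bialgebra_hom_def is_bialgebra_def\<close>)
qed (use bialgebra_arr[OF X] bialgebra_arr[OF Y] in
    \<open>auto simp: tensor_comult_def tensor_counit_def mult_unit_def\<close>)

lemma \<Phi>_coalgebra_hom: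
  "coalgebra_hom C (r \<otimes> b) (tensor_comult C R B) (tensor_counit C R B)
    (Carrier A) (Comult A) (Counit A) \<Phi>"
  unfolding \<Phi>_def by (intro mult_A_coalgebra_hom i_hom \<sigma>_hom R_bialgebra B_bialgebra)

lemma \<Psi>_coalgebra_hom:
  "coalgebra_hom C (b \<otimes> r) (tensor_comult C B R) (tensor_counit C B R)
    (r \<otimes> b) (tensor_comult C R B) (tensor_counit C R B) \<Psi>"
  unfolding \<Psi>_def
proof (rule coalgebra_hom_comp)
  show "coalgebra_hom C (b \<otimes> r) (tensor_comult C B R) (tensor_counit C B R)
      (Carrier A) (Comult A) (Counit A) \<Theta>"
    unfolding \<Theta>_def by (intro mult_A_coalgebra_hom i_hom \<sigma>_hom R_bialgebra B_bialgebra)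
  show "coalgebra_hom C (Carrier A) (Comult A) (Counit A)
      (r \<otimes> b) (tensor_comult C R B) (tensor_counit C R B) (inv \<Phi>)"
    by (rule coalgebra_hom_inv[OF \<Phi>_coalgebra_hom]) auto
qed auto

definition left_act where "left_act = onto_R \<cdot> \<Psi>"
definition right_act where "right_act = onto_B \<cdot> \<Psi>"

lemma act_arr [simp]:
  "left_act \<in> Arr C" "Dom C left_act = b \<otimes> r" "Cod C left_act = r"
  "right_act \<in> Arr C" "Dom C right_act = b \<otimes> r" "Cod C right_act = b"
  by (simp_all add: left_act_def right_act_def)

lemma act_coalgebra_hom:
  "coalgebra_hom C (b \<otimes> r) (tensor_comult C B R) (tensor_counit C B R) r (Comult R) (Counit R) left_act"
  "coalgebra_hom C (b \<otimes> r) (tensor_comult C B R) (tensor_counit C B R) b (Comult B) (Counit B) right_act"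
  unfolding left_act_def right_act_def
  by (rule coalgebra_hom_comp[OF \<Psi>_coalgebra_hom onto_R_coalgebra_hom]
      coalgebra_hom_comp[OF \<Psi>_coalgebra_hom onto_B_coalgebra_hom]; simp)+

lemma \<Psi>_comult: "tensor_comult C R B \<cdot> \<Psi> = (\<Psi> \<boxtimes> \<Psi>) \<cdot> tensor_comult C B R"
  using \<Psi>_coalgebra_hom by (simp add: coalgebra_hom_def)

text \<open>
  The exchange map is recovered from the two actions: \<open>\<Psi>\<close> commutes with the comultiplications, and
  the projections paired along that of \<open>R \<otimes> B\<close> give the identity.
\<close>

lemma left_act_right_act: "(left_act \<boxtimes> right_act) \<cdot> tensor_comult C B R = \<Psi>"
proof -
  have "(left_act \<boxtimes> right_act) \<cdot> tensor_comult C B R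
      = (onto_R \<boxtimes> onto_B) \<cdot> (\<Psi> \<boxtimes> \<Psi>) \<cdot> tensor_comult C B R"
    by (simp add: left_act_def right_act_def)
  also have "\<dots> = ((onto_R \<boxtimes> onto_B) \<cdot> tensor_comult C R B) \<cdot> \<Psi>"
    by (simp only: \<Psi>_comult[symmetric]) simp
  finally show ?thesis by (simp add: onto_R_onto_B del: comp_assoc_arr)
qed

lemma right_act_left_act: "(right_act \<boxtimes> left_act) \<cdot> tensor_comult C B R = \<c> r b \<cdot> \<Psi>"
proof -
  have "(right_act \<boxtimes> left_act) \<cdot> tensor_comult C B R
      = (onto_B \<boxtimes> onto_R) \<cdot> (\<Psi> \<boxtimes> \<Psi>) \<cdot> tensor_comult C B R"
    by (simp add: left_act_def right_act_def)
  also have "\<dots> = ((onto_B \<boxtimes> onto_R) \<cdot> tensor_comult C R B) \<cdot> \<Psi>"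
    by (simp only: \<Psi>_comult[symmetric]) simp
  finally show ?thesis by (simp add: onto_B_onto_R del: comp_assoc_arr)
qed


section \<open>The matched pair\<close>

lemma counit_mult:
  "Counit B \<cdot> Mult B = \<l> \<one> \<cdot> (Counit B \<boxtimes> Counit B)" "Counit B \<cdot> Unit B = id \<one>"
  "Counit R \<cdot> Mult R = \<l> \<one> \<cdot> (Counit R \<boxtimes> Counit R)" "Counit R \<cdot> Unit R = id \<one>"
  using B_bialgebra R_bialgebra by (simp_all add: is_bialgebra_def mult_unit_def)

text \<open>
  Projecting the distributive law to \<open>R\<close> kills the product in \<open>B\<close>, because the counit of \<open>B\<close> is
  multiplicative. Each of the two copies of \<open>\<Psi>\<close> then meets its own counit and becomes an action.
\<close>

lemma left_act_mult:
  "left_act \<cdot> (Mult B \<boxtimes> id r) = left_act \<cdot> (id b \<boxtimes> left_act) \<cdot> \<a> b b r"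
proof -
  have "onto_R \<cdot> (id r \<boxtimes> Mult B) = drop_right r (\<l> \<one> \<cdot> (Counit B \<boxtimes> Counit B))"
    by (simp add: drop_right_nat counit_mult)
  then have onto: "(onto_R \<cdot> (id r \<boxtimes> Mult B)) \<cdot> \<a> r b b = onto_R \<cdot> (onto_R \<boxtimes> id b)"
    by (simp add: drop_right_twice)
  have "left_act \<cdot> (Mult B \<boxtimes> id r)
      = ((onto_R \<cdot> (id r \<boxtimes> Mult B)) \<cdot> \<a> r b b) \<cdot> (\<Psi> \<boxtimes> id b) \<cdot> inv (\<a> b r b) \<cdot> (id b \<boxtimes> \<Psi>) \<cdot> \<a> b b r"
    by (simp add: left_act_def \<Psi>_mult_B)
  also have "\<dots> = onto_R \<cdot> (left_act \<boxtimes> id b) \<cdot> inv (\<a> b r b) \<cdot> (id b \<boxtimes> \<Psi>) \<cdot> \<a> b b r"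
    unfolding onto by (simp add: left_act_def)
  also have "\<dots> = left_act \<cdot> (drop_right (b \<otimes> r) (Counit B) \<cdot> inv (\<a> b r b)) \<cdot> (id b \<boxtimes> \<Psi>) \<cdot> \<a> b b r"
    by (simp add: comp_extend[OF drop_right_nat])
  also have "\<dots> = left_act \<cdot> (id b \<boxtimes> left_act) \<cdot> \<a> b b r"
    by (simp add: drop_right_tensor left_act_def)
  finally show ?thesis .
qed

lemma right_act_mult:
  "right_act \<cdot> (right_act \<boxtimes> id r) = right_act \<cdot> (id b \<boxtimes> Mult R) \<cdot> \<a> b r r"
proof -
  have "onto_B \<cdot> (Mult R \<boxtimes> id b) = drop_left (\<l> \<one> \<cdot> (Counit R \<boxtimes> Counit R)) b"
    by (simp add: drop_left_nat counit_mult)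
  then have onto: "(onto_B \<cdot> (Mult R \<boxtimes> id b)) \<cdot> inv (\<a> r r b) = onto_B \<cdot> (id r \<boxtimes> onto_B)"
    by (simp add: drop_left_twice)
  have "right_act \<cdot> (id b \<boxtimes> Mult R) \<cdot> \<a> b r r
      = onto_B \<cdot> (\<Psi> \<cdot> (id b \<boxtimes> Mult R)) \<cdot> \<a> b r r"
    by (simp add: right_act_def)
  also have "\<dots> = ((onto_B \<cdot> (Mult R \<boxtimes> id b)) \<cdot> inv (\<a> r r b)) \<cdot> (id r \<boxtimes> \<Psi>) \<cdot> \<a> r b r \<cdot> (\<Psi> \<boxtimes> id r)"
    unfolding \<Psi>_mult_R by simp
  also have "\<dots> = onto_B \<cdot> (id r \<boxtimes> right_act) \<cdot> \<a> r b r \<cdot> (\<Psi> \<boxtimes> id r)"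
    unfolding onto by (simp add: right_act_def)
  also have "\<dots> = right_act \<cdot> (drop_left (Counit R) (b \<otimes> r) \<cdot> \<a> r b r) \<cdot> (\<Psi> \<boxtimes> id r)"
    by (simp add: comp_extend[OF drop_left_nat])
  also have "\<dots> = right_act \<cdot> (right_act \<boxtimes> id r)"
    by (simp add: drop_left_tensor right_act_def)
  finally show ?thesis by simp
qed

lemma act_unit:
  "left_act \<cdot> (Unit B \<boxtimes> id r) = \<l> r"
  "right_act \<cdot> (Unit B \<boxtimes> id r) = Unit B \<cdot> Counit R \<cdot> \<l> r"
  "right_act \<cdot> (id b \<boxtimes> Unit R) = \<r> b"
  "left_act \<cdot> (id b \<boxtimes> Unit R) = Unit R \<cdot> Counit B \<cdot> \<r> b"
proof -
  show "left_act \<cdot> (Unit B \<boxtimes> id r) = \<l> r"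
    by (simp add: left_act_def \<Psi>_unit_B comp_extend[OF drop_right_nat] counit_mult drop_right_id)
  show "right_act \<cdot> (id b \<boxtimes> Unit R) = \<r> b"
    by (simp add: right_act_def \<Psi>_unit_R comp_extend[OF drop_left_nat] counit_mult drop_left_id)
  have "drop_left (Counit R) \<one> = Counit R \<cdot> \<r> r"
    by (simp add: drop_left_def lunit_eq_runit[symmetric] runit_nat)
  then show "right_act \<cdot> (Unit B \<boxtimes> id r) = Unit B \<cdot> Counit R \<cdot> \<l> r"
    by (simp add: right_act_def \<Psi>_unit_B comp_extend[OF drop_left_nat])
  have "drop_right \<one> (Counit B) = Counit B \<cdot> \<l> b"
    by (simp add: drop_right_def lunit_eq_runit lunit_nat)
  then show "left_act \<cdot> (id b \<boxtimes> Unit R) = Unit R \<cdot> Counit B \<cdot> \<r> b"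
    by (simp add: left_act_def \<Psi>_unit_R comp_extend[OF drop_right_nat])
qed

text \<open>
  Projecting the same law to \<open>B\<close> keeps the product in \<open>B\<close>, and only the outer copy of \<open>\<Psi>\<close>
  becomes an action. The inner one is the pairing of both actions, by \<open>left_act_right_act\<close>.
\<close>

lemma right_act_mult_B:
  "right_act \<cdot> (Mult B \<boxtimes> id r)
    = Mult B \<cdot> (right_act \<boxtimes> id b) \<cdot> inv (\<a> b r b) \<cdot> (id b \<boxtimes> \<Psi>) \<cdot> \<a> b b r"
proof -
  have "right_act \<cdot> (Mult B \<boxtimes> id r)
      = (onto_B \<cdot> (id r \<boxtimes> Mult B)) \<cdot> \<a> r b b \<cdot> (\<Psi> \<boxtimes> id b) \<cdot> inv (\<a> b r b) \<cdot> (id b \<boxtimes> \<Psi>) \<cdot> \<a> b b r"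
    by (simp add: right_act_def \<Psi>_mult_B)
  also have "onto_B \<cdot> (id r \<boxtimes> Mult B) = Mult B \<cdot> drop_left (Counit R) (b \<otimes> b)"
    by (simp add: drop_left_nat)
  finally show ?thesis
    by (simp add: comp_extend[OF drop_left_tensor] right_act_def)
qed

lemma left_act_mult_R:
  "left_act \<cdot> (id b \<boxtimes> Mult R)
    = Mult R \<cdot> (id r \<boxtimes> left_act) \<cdot> \<a> r b r \<cdot> (\<Psi> \<boxtimes> id r) \<cdot> inv (\<a> b r r)"
proof -
  have "left_act \<cdot> (id b \<boxtimes> Mult R)
      = (onto_R \<cdot> (Mult R \<boxtimes> id b)) \<cdot> inv (\<a> r r b) \<cdot> (id r \<boxtimes> \<Psi>) \<cdot> \<a> r b r \<cdot> (\<Psi> \<boxtimes> id r) \<cdot> inv (\<a> b r r)"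
    by (simp add: left_act_def \<Psi>_mult_R)
  also have "onto_R \<cdot> (Mult R \<boxtimes> id b) = Mult R \<cdot> drop_right (r \<otimes> r) (Counit B)"
    by (simp add: drop_right_nat)
  finally show ?thesis
    by (simp add: comp_extend[OF drop_right_tensor] left_act_def)
qed

lemma matched_pair_acts: "matched_pair C R B left_act right_act"
proof -
  have "left_module_coalgebra C B R left_act"
    using R_coalgebra act_coalgebra_hom left_act_mult act_unit
    by (simp add: left_module_coalgebra_def left_action_def)
  moreover have "right_module_coalgebra C R B right_act"
    using B_coalgebra act_coalgebra_hom right_act_mult act_unit
    by (simp add: right_module_coalgebra_def right_action_def)
  ultimately show ?thesis
    using R_bialgebra B_bialgebra
    by (simp add: matched_pair_def act_unit left_act_right_act right_act_left_act
        right_act_mult_B left_act_mult_R)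
qed


section \<open>The double cross product\<close>

abbreviation cross where "cross \<equiv> double_cross_product C R B left_act right_act"

lemma cross_sel:
  "Carrier cross = r \<otimes> b" "Unit cross = (Unit R \<boxtimes> Unit B) \<cdot> comult_unit C"
  "Comult cross = tensor_comult C R B" "Counit cross = tensor_counit C R B"
  by (simp_all add: double_cross_product_def Let_def tensor_comult_def tensor_counit_def)

lemma cross_mult:
  "Mult cross = (Mult R \<boxtimes> Mult B) \<cdot> inv (rebracket C r r b b) \<cdot> (id r \<boxtimes> (\<Psi> \<boxtimes> id b)) \<cdot> rebracket C r b r b"
  by (simp add: double_cross_product_def Let_def left_act_right_act[symmetric] tensor_comult_def)

text \<open>
  With \<open>\<Psi>\<close> in place of the paired actions, this is the computation
  \<open>i (i \<sigma>) \<sigma> = i (\<sigma> i) \<sigma>\<close> in \<open>A\<close>, where the inner \<open>i \<sigma>\<close> is precomposed with \<open>\<Psi>\<close>.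
\<close>

lemma \<Phi>_cross_mult: "\<Phi> \<cdot> Mult cross = Mult A \<cdot> (\<Phi> \<boxtimes> \<Phi>)"
proof -
  have "\<Phi> \<cdot> Mult cross
      = ((i \<star> i) \<star> (\<sigma> \<star> \<sigma>)) \<cdot> inv (rebracket C r r b b) \<cdot> (id r \<boxtimes> (\<Psi> \<boxtimes> id b)) \<cdot> rebracket C r b r b"
    by (simp add: \<Phi>_def cross_mult comp_extend[OF arrow_product_comp] hom_mult)
  also have "\<dots> = (i \<star> (\<Phi> \<star> \<sigma>)) \<cdot> (id r \<boxtimes> (\<Psi> \<boxtimes> id b)) \<cdot> rebracket C r b r b"
    by (simp add: arrow_product_rebracket \<Phi>_def)
  also have "\<dots> = (i \<star> ((\<sigma> \<star> i) \<star> \<sigma>)) \<cdot> rebracket C r b r b"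
    by (simp add: comp_extend[OF arrow_product_comp] arrow_product_comp \<Phi>_\<Psi> \<Theta>_def)
  also have "\<dots> = (i \<star> \<sigma>) \<star> (i \<star> \<sigma>)"
    by (simp add: arrow_product_rebracket)
  finally show ?thesis
    by (simp add: \<Phi>_def arrow_product_def)
qed

lemma \<Phi>_cross_unit: "\<Phi> \<cdot> Unit cross = Unit A"
proof -
  have "\<Phi> \<cdot> Unit cross = (Unit A \<star> Unit A) \<cdot> inv (\<l> \<one>)"
    by (simp add: cross_sel \<Phi>_def comp_extend[OF arrow_product_comp] hom_unit
        comult_unit_def mult_unit_def)
  then show ?thesis
    by (simp add: unit_arrow_product lunit_eq_runit)
qed

lemma \<Phi>_cross_hom: "bialgebra_hom C cross A \<Phi>"
  using \<Phi>_cross_mult \<Phi>_cross_unit \<Phi>_coalgebra_hom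
  by (simp add: bialgebra_hom_def algebra_hom_def cross_sel)

lemma isomorphic_cross: "isomorphic_bialgebras C A cross"
proof -
  have "is_bialgebra C cross"
    by (rule bialgebra_transport[OF A_bialgebra \<Phi>_cross_hom \<Phi>_iso])
      (simp_all add: cross_sel cross_mult comult_unit_def mult_unit_def)
  then show ?thesis
    using bialgebra_hom_inv[OF _ A_bialgebra \<Phi>_cross_hom \<Phi>_iso] iso_inv[OF \<Phi>_iso] A_bialgebra
    by (auto simp: isomorphic_bialgebras_def)
qed

end

theorem theorem2p15:
  fixes C :: "('o, 'm) braided_monoidal_category" (structure)
    and A B R :: "('o, 'm) bialgebra"
    and \<sigma> i \<Phi> \<Theta> \<Psi> la ra :: 'm
  assumes "braided_monoidal_category C"
    and "is_bialgebra C A" and "is_bialgebra C B" and "is_bialgebra C R"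
    and "bialgebra_hom C B A \<sigma>" and "bialgebra_hom C R A i"
    and "\<Phi> = Mult A \<cdot> (i \<boxtimes> \<sigma>)"
    and "is_iso C \<Phi>"
    and "\<Theta> = Mult A \<cdot> (\<sigma> \<boxtimes> i)"
    and "\<Psi> = inv \<Phi> \<cdot> \<Theta>"
    and "la = \<r> (Carrier R) \<cdot> (id (Carrier R) \<boxtimes> Counit B) \<cdot> \<Psi>"
    and "ra = \<l> (Carrier B) \<cdot> (Counit R \<boxtimes> id (Carrier B)) \<cdot> \<Psi>"
  shows "matched_pair C R B la ra \<and>
         isomorphic_bialgebras C A (double_cross_product C R B la ra)"
proof -
  interpret braided_monoidal_category C by fact
  interpret F: bialgebra_factorisation C A B R \<sigma> i
    by standard (use assms in simp_all)
  have \<Psi>: "\<Psi> = F.\<Psi>"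
    by (simp add: assms F.\<Psi>_def F.\<Phi>_def F.\<Theta>_def F.arrow_product_def)
  have "la = F.left_act" "ra = F.right_act"
    by (simp_all add: assms(11,12) \<Psi> F.left_act_def F.right_act_def drop_right_def drop_left_def)
  then show ?thesis
    using F.matched_pair_acts F.isomorphic_cross by simp
qed

end
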